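(* Let $s,k\in\mathbb{N}$ with $s\geq k(k+1)$, let $\epsilon$ be a sufficiently small positive real number, and let $\Lambda$ be as defined in the context. Let $A\subseteq\mathbb{Z}$ be a non-empty finite set with $|A|$ large enough, and let $\alpha\leq 1$ be any (positive) real number such that \[ \log{\alpha^{-1}} \leq \frac{\epsilon(k(k+1)-2\Lambda)}{43200}\log{|A|} \quad\text{and}\quad J_{s,k}(A) = \alpha|A|^{2s-k(k+1)/2+\Lambda}. \] Then $|AA| > |A|^{1+\delta}$, where $\delta$ is some positive constant depending only on $k$ and $\Lambda$.
   Context: For a finite set $A$ and natural numbers $s,k$, $J_{s,k}(A)$ denotes the number of solutions $(x_1,\dots,x_s,y_1,\dots,y_s)\in A^{2s}$ of the system $\sum_{i=1}^s x_i^j = \sum_{i=1}^s y_i^j$ for $1\le j\le k$. Let $\mathcal{U}\subseteq\mathbb{R}$ be the set of all $\lambda$ such that $J_{s,k}(A)\le |A|^{2s-k(k+1)/2}|A|^{\lambda}$ for all $(s,k)\in\mathbb{N}^2$ with $s\ge k(k+1)/2$ and all finite non-empty $A\subseteq\mathbb{Z}$ with $|A|$ large enough with respect to $\lambda,s,k$; and $\Lambda=\inf\mathcal{U}$. $AA=\{a_1a_2 : a_1,a_2\in A\}$. *)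

theory Defs
  imports Complex_Main "HOL-Library.FuncSet" "HOL-Library.Set_Algebras"
    "HOL-Library.Extended_Real"
begin

definition J :: "nat \<Rightarrow> nat \<Rightarrow> int set \<Rightarrow> nat" where
  "J s k A = card {(x, y). x \<in> {1..s} \<rightarrow>\<^sub>E A \<and> y \<in> {1..s} \<rightarrow>\<^sub>E A \<and>
     (\<forall>j\<in>{1..k}. (\<Sum>i=1..s. x i ^ j) = (\<Sum>i=1..s. y i ^ j))}"

(* The natural numbers of the source are the positive integers, hence the guards s \<ge> 1, k \<ge> 1. *)
definition admissible_exponents :: "real set" where
  "admissible_exponents = {l. \<forall>s k :: nat. s \<ge> 1 \<and> k \<ge> 1 \<and> real s \<ge> real k * (real k + 1) / 2 \<longrightarrow>
     (\<exists>N::nat. \<forall>A :: int set. finite A \<and> A \<noteq> {} \<and> card A \<ge> N \<longrightarrow>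
        real (J s k A) \<le>
          real (card A) powr (2 * real s - real k * (real k + 1) / 2) * real (card A) powr l)}"

(* The infimum is taken in the extended reals, so that it would be \<infinity> if there were no
   admissible exponent; on type real, the infimum of the empty set is an unspecified number. *)
definition Lambda_inf :: ereal where
  "Lambda_inf = Inf (ereal ` admissible_exponents)"

end

theory Submission
  imports Defs "HOL-Library.Function_Algebras" "HOL-Analysis.Convex"
begin

text \<open>Let \<open>t = k (k + 1) / 2\<close> and \<open>n = |A|\<close>. Since \<open>\<Lambda>\<close> is an infimum, \<open>J t k A\<close> is at most
  \<open>n\<^sup>t\<close> times \<open>n\<close> to the power \<open>\<Lambda> + o(1)\<close>, while the lower bound for \<open>J s k A\<close> passes down to
  \<open>J (2 t) k A\<close> because each further pair of variables costs a factor of at most \<open>n\<^sup>2\<close>. So \<open>J (2 t) k A\<close> is,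
  up to a tiny power \<open>K\<close> of \<open>n\<close>, equal to its trivial upper bound, \<open>n\<close> to the power \<open>2 t\<close> times
  \<open>J t k A\<close>. By the Balog--Szemeredi--Gowers theorem the \<open>t\<close>-fold sums of points of the moment curve
  over a large part \<open>B\<close> of \<open>A\<close> lie in an approximate group in \<open>\<int>\<^sup>k\<close>, and so does their first coordinate
  \<open>X = B + ... + B\<close> in \<open>\<int>\<close>; moreover any dense subset of \<open>B\<close> has a \<open>t\<close>-fold sumset
  almost as large as \<open>X\<close>. If \<open>AA\<close> is small, then \<open>aB\<close> and \<open>bB\<close> have a large intersection for a fixed \<open>b\<close> and
  all \<open>a\<close> in a dense subset \<open>C\<close> of \<open>B\<close>, so that \<open>aX\<close> is covered by few translates of \<open>b (X - X)\<close>. This property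
  survives boundedly many additions, hence holds for all differences of elements of \<open>W = C + ... + C\<close>.
  If \<open>u / v\<close> is the largest quotient of such differences, then \<open>(u + v) / v\<close> is no quotient of differences and
  \<open>v W + (u + v) W\<close> has \<open>|W|\<^sup>2\<close> elements, which is too many unless \<open>n\<close> is bounded by a fixed power of \<open>K\<close>.\<close>

section \<open>Sumsets\<close>

fun nsum :: "nat \<Rightarrow> 'a::comm_monoid_add set \<Rightarrow> 'a set" where
  "nsum 0 S = {0}"
| "nsum (Suc n) S = S + nsum n S"

lemma finite_nsum [simp]: "finite S \<Longrightarrow> finite (nsum n S)"
  by (induction n) (auto intro: finite_set_plus)

lemma nsum_nonempty: "S \<noteq> {} \<Longrightarrow> nsum n S \<noteq> {}"
  by (induction n) (auto simp: set_plus_def)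

lemma nsum_mono: "S \<subseteq> T \<Longrightarrow> nsum n S \<subseteq> nsum n T"
  by (induction n) (simp_all add: set_plus_mono2)

lemma singleton_0_plus [simp]: "{0} + S = (S :: 'a::comm_monoid_add set)"
  by (auto simp: set_plus_def)

lemma nsum_add: "nsum (m + n) S = nsum m S + nsum n S"
  by (induction m) (simp_all add: add.assoc)

lemma nsum_nsum: "nsum m (nsum n S) = nsum (m * n) S"
  by (induction m) (simp_all add: nsum_add)

lemma image_set_plus:
  assumes "\<And>x y. f (x + y) = f x + f y"
  shows "f ` (S + T) = f ` S + f ` T"
  by (fastforce simp: set_plus_def assms image_iff)

lemma nsum_image:
  assumes "f 0 = 0" "\<And>x y. f (x + y) = f x + f y"
  shows "f ` nsum n S = nsum n (f ` S)"
  by (induction n) (simp_all add: assms image_set_plus)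

lemma card_le_nsum:
  fixes S :: "'a::cancel_comm_monoid_add set"
  assumes "finite S" "n \<ge> 1"
  shows "card S \<le> card (nsum n S)"
proof (cases "S = {}")
  case False
  obtain m where n: "n = Suc m" using assms(2) by (cases n) auto
  obtain c where c: "c \<in> nsum m S" using nsum_nonempty[OF False] by blast
  have "card S = card ((\<lambda>x. x + c) ` S)"
    by (simp add: card_image)
  also have "\<dots> \<le> card (nsum n S)"
    by (rule card_mono) (use assms c in \<open>auto simp: n set_plus_def intro: finite_set_plus\<close>)
  finally show ?thesis .
qed auto

lemma card_translate:
  fixes S :: "'a::cancel_comm_monoid_add set"
  shows "card (S + {c}) = card S"
proof -
  have "S + {c} = (\<lambda>x. x + c) ` S" by (auto simp: set_plus_def)
  then show ?thesis by (simp add: card_image)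
qed

lemma card_uminus [simp]: "card (uminus ` S) = card (S :: 'a::ab_group_add set)"
  by (rule card_image) simp

section \<open>Inequalities of Pluennecke and Ruzsa\<close>

lemma card_plus_le:
  assumes "finite S" "finite T"
  shows "card (S + T) \<le> card S * card T"
proof -
  have "S + T = (\<lambda>(x, y). x + y) ` (S \<times> T)"
    by (auto simp: set_plus_def image_iff)
  then show ?thesis
    by (metis assms card_cartesian_product card_image_le finite_cartesian_product)
qed

text \<open>The hypothesis \<open>min\<close> says, cross-multiplied, that \<open>X\<close>
  minimises the ratio |Z + B| / |Z| among its nonempty subsets. The set \<open>C\<close> is built up
  one element at a time: when \<open>c\<close> is added, minimality limits the growth of
  \<open>X + B + C\<close> in proportion to that of \<open>X + C\<close>.\<close>

lemma petridis:
  fixes X B C :: "'a::ab_group_add set"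
  assumes fin: "finite X" "finite B" "finite C"
    and min: "\<And>Z. Z \<subseteq> X \<Longrightarrow> card (X + B) * card Z \<le> card (Z + B) * card X"
  shows "card (X + B + C) * card X \<le> card (X + B) * card (X + C)"
  using fin(3)
proof (induction C rule: finite_induct)
  case empty
  have "X + {} = {}" "X + B + {} = {}" by (auto simp: set_plus_def)
  then show ?case by simp
next
  case (insert c C)
  \<comment> \<open>With the new element \<open>c\<close>, points of \<open>Z\<close> contribute
    nothing new to \<open>X + B + C\<close>, and points of \<open>W\<close> nothing new to
    \<open>X + C\<close>. As \<open>W \<subseteq> Z\<close>, the second set gains at least |X| - |Z|
    elements.\<close>
  define Z where "Z = {z\<in>X. \<forall>b\<in>B. z + b + c \<in> X + B + C}"
  define W where "W = {z\<in>X. z + c \<in> X + C}"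
  have ZX: "Z \<subseteq> X" and WX: "W \<subseteq> X" by (auto simp: Z_def W_def)
  have WZ: "W \<subseteq> Z"
  proof
    fix z assume z: "z \<in> W"
    then obtain x d where xd: "x \<in> X" "d \<in> C" "z + c = x + d"
      by (auto simp: W_def set_plus_def)
    have "z + b + c \<in> X + B + C" if "b \<in> B" for b
    proof -
      have "z + b + c = (x + b) + d" using xd(3) by (metis add.assoc add.commute)
      moreover have "(x + b) + d \<in> X + B + C" using xd that by (intro set_plus_intro)
      ultimately show ?thesis by (simp only:)
    qed
    then show "z \<in> Z" using z by (auto simp: Z_def W_def)
  qed
  have finZ: "finite Z" "finite W" using ZX WX fin finite_subset by blast+
  note fs = finite_set_plus
  have fXB: "finite (X + B)" "finite (Z + B)" "finite (X + B + C)" "finite (X + C)"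
    using fin insert finZ by (auto intro!: fs)
  have sub: "Z + B \<subseteq> X + B" using ZX by (rule set_plus_mono2) simp
  have 1: "X + B + insert c C \<subseteq> (X + B + C) \<union> ((X + B) - (Z + B) + {c})"
  proof
    fix w assume "w \<in> X + B + insert c C"
    then obtain x b d where w: "x \<in> X" "b \<in> B" "d = c \<or> d \<in> C" "w = x + b + d"
      by (auto simp: set_plus_def)
    show "w \<in> (X + B + C) \<union> ((X + B) - (Z + B) + {c})"
    proof (cases "d \<in> C")
      case True
      then show ?thesis using w by (auto simp: set_plus_def)
    next
      case False
      then have d: "d = c" using w by auto
      show ?thesis
      proof (cases "x + b \<in> Z + B")
        case True
        then obtain z b' where "z \<in> Z" "b' \<in> B" "x + b = z + b'" by (auto simp: set_plus_def)
        then show ?thesis using w d by (auto simp: Z_def)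
      next
        case False
        then show ?thesis using w d by (auto simp: set_plus_def)
      qed
    qed
  qed
  have "card (X + B + insert c C) \<le> card ((X + B + C) \<union> ((X + B) - (Z + B) + {c}))"
    by (rule card_mono[OF _ 1]) (use fXB in \<open>auto intro!: fs\<close>)
  also have "\<dots> \<le> card (X + B + C) + card ((X + B) - (Z + B))"
    using card_Un_le card_translate by metis
  also have "card ((X + B) - (Z + B)) = card (X + B) - card (Z + B)"
    using card_Diff_subset fXB sub by blast
  finally have u1: "card (X + B + insert c C) + card (Z + B) \<le> card (X + B + C) + card (X + B)"
    using card_mono[OF fXB(1) sub] by linarith
  have "(X + C) \<union> ((X - W) + {c}) \<subseteq> X + insert c C"
    by (auto simp: set_plus_def)
  moreover have "(X + C) \<inter> ((X - W) + {c}) = {}"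
    by (auto simp: W_def elim!: set_plus_elim) (metis set_plus_intro)
  ultimately have "card (X + C) + card ((X - W) + {c}) \<le> card (X + insert c C)"
    using fXB fin insert.hyps finZ
    by (subst card_Un_disjoint[symmetric]) (auto intro!: card_mono fs)
  moreover have "card ((X - W) + {c}) = card X - card W"
    using card_translate card_Diff_subset finZ WX by metis
  moreover have "card W \<le> card Z" "card Z \<le> card X"
    using card_mono finZ fin WZ ZX by blast+
  ultimately have u2: "card (X + C) + card X \<le> card (X + insert c C) + card Z"
    by linarith
  \<comment> \<open>Minimality compares the two increments: (|X + B| - |Z + B|) |X| \<le> |X + B|
    (|X| - |Z|).\<close>
  have "card (X + B + insert c C) * card X + card (Z + B) * card X
      \<le> card (X + B + C) * card X + card (X + B) * card X"
    using mult_right_mono[OF u1, of "card X"] by (simp add: algebra_simps)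
  also have "\<dots> \<le> card (X + B) * (card (X + C) + card X)"
    using insert.IH by (simp add: algebra_simps)
  also have "\<dots> \<le> card (X + B) * (card (X + insert c C) + card Z)"
    using u2 by simp
  finally show ?case
    using min[OF ZX] by (simp add: algebra_simps)
qed

text \<open>Choose a nonempty \<open>X \<subseteq> A\<close> minimising |Z + B| / |Z|; its ratio is
  at most that of \<open>A\<close>, hence at most \<open>K\<close>. Then \<open>petridis\<close>
  with \<open>C = nsum n B\<close> costs one factor \<open>K\<close> per summand, with the same
  \<open>X\<close> for every \<open>n\<close>.\<close>

lemma pluennecke:
  fixes A B :: "'a::ab_group_add set" and K :: real
  assumes "finite A" "A \<noteq> {}" "finite B" "real (card (A + B)) \<le> K * real (card A)"
  shows "\<exists>X\<subseteq>A. X \<noteq> {} \<and> (\<forall>n. real (card (X + nsum n B)) \<le> K ^ n * real (card X))"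
proof -
  define r where "r Z = real (card (Z + B)) / real (card Z)" for Z
  have fP: "finite {Z. Z \<subseteq> A \<and> Z \<noteq> {}}" using assms(1) by simp
  obtain X where X: "X \<subseteq> A" "X \<noteq> {}" and least: "\<And>Z. Z \<subseteq> A \<Longrightarrow> Z \<noteq> {} \<Longrightarrow> r X \<le> r Z"
    using ex_is_arg_min_if_finite[OF fP, of r] assms(2) unfolding is_arg_min_linorder
    by (metis (mono_tags, lifting) empty_iff mem_Collect_eq subset_refl)
  have fX: "finite X" using X assms finite_subset by blast
  have c0: "card X > 0" using X fX by (simp add: card_gt_0_iff)
  have cA: "card A > 0" using assms by (simp add: card_gt_0_iff)
  have rK: "real (card (X + B)) \<le> K * real (card X)"
  proof -
    have "r X \<le> r A" using least assms(2) by blast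
    also have "\<dots> \<le> K" using assms(4) cA by (simp add: r_def field_simps)
    finally show ?thesis using c0 by (simp add: r_def field_simps)
  qed
  have min: "card (X + B) * card Z \<le> card (Z + B) * card X" if "Z \<subseteq> X" for Z
  proof (cases "Z = {}")
    case False
    then have "card Z > 0" using that fX finite_subset by (metis card_gt_0_iff)
    moreover have "r X \<le> r Z" using least False that X by blast
    ultimately have "real (card (X + B) * card Z) \<le> real (card (Z + B) * card X)"
      using c0 by (simp add: r_def field_simps)
    then show ?thesis using of_nat_le_iff by blast
  qed simp
  have "real (card (X + nsum n B)) \<le> K ^ n * real (card X)" for n
  proof (induction n)
    case 0
    have "X + nsum 0 B = X" by (auto simp: set_plus_def)
    then show ?case by simp
  next
    case (Suc n)
    have "card (X + B + nsum n B) * card X \<le> card (X + B) * card (X + nsum n B)"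
      by (rule petridis) (use fX assms min in auto)
    then have "real (card (X + nsum (Suc n) B)) * real (card X)
        \<le> real (card (X + B)) * real (card (X + nsum n B))"
      by (simp add: add.assoc flip: of_nat_mult)
    also have "\<dots> \<le> (K * real (card X)) * (K ^ n * real (card X))"
      by (rule mult_mono) (use rK Suc in \<open>auto intro: order_trans[OF of_nat_0_le_iff rK]\<close>)
    finally show ?case using c0 by (simp add: field_simps)
  qed
  then show ?thesis using X by blast
qed

text \<open>Fix one representation d = u - w of each difference. The pair (u - x, x - w) has sum d,
  so it determines d, then u and w, and finally x.\<close>

lemma ruzsa_triangle:
  fixes U W X :: "'a::ab_group_add set"
  assumes "finite U" "finite W" "finite X"
  shows "card (U + uminus ` W) * card X \<le> card (U + uminus ` X) * card (X + uminus ` W)"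
proof -
  have "\<forall>d\<in>U + uminus ` W. \<exists>p. fst p \<in> U \<and> snd p \<in> W \<and> d = fst p - snd p"
    by (force simp: set_plus_def)
  then obtain p where p: "\<And>d. d \<in> U + uminus ` W \<Longrightarrow> fst (p d) \<in> U \<and> snd (p d) \<in> W \<and> d = fst (p d) - snd (p d)"
    by metis
  define f where "f = (\<lambda>(d, x). (fst (p d) - x, x - snd (p d)))"
  have "inj_on f ((U + uminus ` W) \<times> X)"
  proof (rule inj_onI)
    fix q q' assume q: "q \<in> (U + uminus ` W) \<times> X" "q' \<in> (U + uminus ` W) \<times> X" "f q = f q'"
    obtain d x d' x' where e: "q = (d, x)" "q' = (d', x')" by fastforce
    have "fst (p d) - x = fst (p d') - x'" "x - snd (p d) = x' - snd (p d')"
      using q by (auto simp: f_def e)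
    then have "fst (p d) - snd (p d) = fst (p d') - snd (p d')"
      by (metis add_diff_eq diff_add_cancel)
    then have "d = d'" using p q e by (metis mem_Sigma_iff)
    then show "q = q'" using q by (auto simp: f_def e)
  qed
  moreover have "f ` ((U + uminus ` W) \<times> X) \<subseteq> (U + uminus ` X) \<times> (X + uminus ` W)"
    using p by (force simp: f_def set_plus_def)
  moreover have "finite ((U + uminus ` X) \<times> (X + uminus ` W))"
    using assms by (auto intro!: finite_set_plus)
  ultimately have "card ((U + uminus ` W) \<times> X) \<le> card ((U + uminus ` X) \<times> (X + uminus ` W))"
    by (rule card_inj_on_le)
  then show ?thesis by (simp add: card_cartesian_product)
qed

text \<open>Take \<open>Y \<subseteq> X\<close> of maximal size such that the translates y + D are
  disjoint. Disjointness inside \<open>X + D\<close> bounds |Y| by \<open>K\<close>; by maximality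
  each x + D meets some y + D, which puts x into y + D - D.\<close>

lemma ruzsa_covering:
  fixes X D :: "'a::ab_group_add set" and K :: real
  assumes "finite X" "finite D" "D \<noteq> {}" "real (card (X + D)) \<le> K * real (card D)"
  shows "\<exists>Y\<subseteq>X. real (card Y) \<le> K \<and> X \<subseteq> Y + (D + uminus ` D)"
proof -
  define F where "F = {Y. Y \<subseteq> X \<and> (\<forall>y\<in>Y. \<forall>y'\<in>Y. y \<noteq> y' \<longrightarrow> ({y} + D) \<inter> ({y'} + D) = {})}"
  have "finite F" "F \<noteq> {}" using assms(1) by (auto simp: F_def)
  then have "Max (card ` F) \<in> card ` F" by (intro Max_in) auto
  then obtain Y where Y: "Y \<in> F" and "card Y = Max (card ` F)" by auto
  then have max: "\<And>Z. Z \<in> F \<Longrightarrow> card Z \<le> card Y" using \<open>finite F\<close> by simp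
  have fY: "finite Y" and YX: "Y \<subseteq> X" using Y assms finite_subset by (auto simp: F_def)
  have "card Y * card D = card (\<Union>y\<in>Y. {y} + D)"
  proof (subst card_UN_disjoint)
    show "card Y * card D = (\<Sum>y\<in>Y. card ({y} + D))"
      using card_translate[of D] by (simp add: add.commute)
  qed (use Y fY assms in \<open>auto simp: F_def intro!: finite_set_plus\<close>)
  also have "\<dots> \<le> card (X + D)"
    by (rule card_mono) (use YX assms in \<open>auto simp: set_plus_def intro!: finite_set_plus\<close>)
  finally have "real (card Y) * real (card D) \<le> K * real (card D)"
    using assms(4) by (metis of_nat_le_iff of_nat_mult order_trans)
  moreover have "real (card D) > 0" using assms by (simp add: card_gt_0_iff)
  ultimately have "real (card Y) \<le> K" by simp
  moreover have "X \<subseteq> Y + (D + uminus ` D)"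
  proof
    fix x assume x: "x \<in> X"
    show "x \<in> Y + (D + uminus ` D)"
    proof (cases "x \<in> Y")
      case True
      obtain d where "d \<in> D" using assms by blast
      then have "0 \<in> D + uminus ` D" by (force simp: set_plus_def)
      then show ?thesis using True by (force simp: set_plus_def)
    next
      case False
      then have "card (insert x Y) > card Y" using fY by simp
      then have "insert x Y \<notin> F" using max by fastforce
      then obtain y where y: "y \<in> Y" "({x} + D) \<inter> ({y} + D) \<noteq> {}"
        using Y x unfolding F_def by (smt (verit) inf_commute insert_iff insert_subset mem_Collect_eq)
      then obtain d d' where d: "d \<in> D" "d' \<in> D" "x + d = y + d'"
        by (auto simp: set_plus_def)
      then have "x = y + (d' + - d)" by (simp add: algebra_simps)
      then show ?thesis using y d by (auto simp: set_plus_def)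
    qed
  qed
  ultimately show ?thesis using YX by blast
qed

section \<open>The Balog--Szemeredi--Gowers theorem\<close>

lemma card_fibre_pairs:
  fixes f :: "'a \<Rightarrow> 'c" and g :: "'b \<Rightarrow> 'c"
  assumes "finite T" "finite S"
  shows "card {(x, y). x \<in> T \<and> y \<in> S \<and> f x = g y}
    = (\<Sum>p\<in>f ` T. card {x\<in>T. f x = p} * card {y\<in>S. g y = p})"
proof -
  have "{(x, y). x \<in> T \<and> y \<in> S \<and> f x = g y} = (\<Union>p\<in>f ` T. {x\<in>T. f x = p} \<times> {y\<in>S. g y = p})"
    by auto
  also have "card \<dots> = (\<Sum>p\<in>f ` T. card ({x\<in>T. f x = p} \<times> {y\<in>S. g y = p}))"
    by (rule card_UN_disjoint) (use assms in auto)
  finally show ?thesis by (simp add: card_cartesian_product)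
qed

text \<open>The count of coincidences between \<open>f\<close> and \<open>g\<close> is the inner
  product of their fibre sizes; the factors on the right are the squared norms.\<close>

lemma card_pairs_cauchy_schwarz:
  fixes f :: "'a \<Rightarrow> 'c" and g :: "'b \<Rightarrow> 'c"
  assumes "finite T" "finite S"
  shows "(card {(x, y). x \<in> T \<and> y \<in> S \<and> f x = g y})\<^sup>2
    \<le> card {(x, y). x \<in> T \<and> y \<in> T \<and> f x = f y} * card {(x, y). x \<in> S \<and> y \<in> S \<and> g x = g y}"
proof -
  define r where "r p = real (card {x\<in>T. f x = p})" for p
  define q where "q p = real (card {x\<in>S. g x = p})" for p
  have 1: "real (card {(x, y). x \<in> T \<and> y \<in> T \<and> f x = f y}) = (\<Sum>p\<in>f ` T. (r p)\<^sup>2)"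
    by (simp add: card_fibre_pairs[OF assms(1,1)] r_def power2_eq_square)
  have "(\<Sum>p\<in>f ` T. (q p)\<^sup>2) = (\<Sum>p\<in>f ` T \<inter> g ` S. (q p)\<^sup>2)"
  proof (rule sum.mono_neutral_right)
    show "\<forall>i\<in>f ` T - f ` T \<inter> g ` S. (q i)\<^sup>2 = 0"
    proof
      fix i assume "i \<in> f ` T - f ` T \<inter> g ` S"
      then have "{x\<in>S. g x = i} = {}" by blast
      then show "(q i)\<^sup>2 = 0" by (simp only: q_def) simp
    qed
  qed (use assms in auto)
  also have "\<dots> \<le> (\<Sum>p\<in>g ` S. (q p)\<^sup>2)"
    by (rule sum_mono2) (use assms in auto)
  also have "\<dots> = real (card {(x, y). x \<in> S \<and> y \<in> S \<and> g x = g y})"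
    by (simp add: card_fibre_pairs[OF assms(2,2)] q_def power2_eq_square)
  finally have 2: "(\<Sum>p\<in>f ` T. (q p)\<^sup>2) \<le> real (card {(x, y). x \<in> S \<and> y \<in> S \<and> g x = g y})" .
  have "(real (card {(x, y). x \<in> T \<and> y \<in> S \<and> f x = g y}))\<^sup>2 = (\<Sum>p\<in>f ` T. r p * q p)\<^sup>2"
    by (simp add: card_fibre_pairs[OF assms] r_def q_def)
  also have "\<dots> \<le> (\<Sum>p\<in>f ` T. (r p)\<^sup>2) * (\<Sum>p\<in>f ` T. (q p)\<^sup>2)"
    by (rule Cauchy_Schwarz_ineq_sum)
  also have "\<dots> \<le> (\<Sum>p\<in>f ` T. (r p)\<^sup>2) * real (card {(x, y). x \<in> S \<and> y \<in> S \<and> g x = g y})"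
    by (rule mult_left_mono[OF 2]) (simp add: sum_nonneg)
  finally have "real ((card {(x, y). x \<in> T \<and> y \<in> S \<and> f x = g y})\<^sup>2)
    \<le> real (card {(x, y). x \<in> T \<and> y \<in> T \<and> f x = f y} * card {(x, y). x \<in> S \<and> y \<in> S \<and> g x = g y})"
    by (simp add: 1)
  then show ?thesis using of_nat_le_iff by blast
qed

text \<open>This is Cauchy--Schwarz against the identity map on the image of \<open>T\<close>, whose
  only coincidences are the trivial ones. It is used to turn few coincidences into a large
  image.\<close>

lemma card_sq_le_card_image:
  fixes f :: "'a \<Rightarrow> 'c"
  assumes "finite T"
  shows "(card T)\<^sup>2 \<le> card {(x, y). x \<in> T \<and> y \<in> T \<and> f x = f y} * card (f ` T)"
proof -
  have "card {(x, y). x \<in> T \<and> y \<in> f ` T \<and> f x = y} = card T"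
    by (rule bij_betw_same_card[of fst]) (auto simp: bij_betw_def inj_on_def image_iff)
  moreover have "card {(x, y). x \<in> f ` T \<and> y \<in> f ` T \<and> x = y} = card (f ` T)"
    by (rule bij_betw_same_card[of fst]) (auto simp: bij_betw_def inj_on_def image_iff)
  ultimately show ?thesis
    using card_pairs_cauchy_schwarz[of T "f ` T" f "\<lambda>x. x"] assms by simp
qed

section \<open>Averaging and paths in dense graphs\<close>

lemma exists_sum_le:
  fixes f g :: "'a \<Rightarrow> real"
  assumes "V \<noteq> {}" "finite V" "c * real (card V) \<le> sum f V"
  shows "\<exists>v\<in>V. c \<le> f v"
proof (rule ccontr)
  assume "\<not> ?thesis"
  then have "sum f V < (\<Sum>v\<in>V. c)"
    by (intro sum_strict_mono) (use assms in auto)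
  then show False using assms by (simp add: mult.commute)
qed

lemma card_conv_sum:
  assumes "finite V"
  shows "real (card {x\<in>V. P x}) = (\<Sum>x\<in>V. if P x then 1 else 0)"
  using assms by (simp add: sum.If_cases Int_def)

text \<open>Dependent random choice: a typical neighbourhood in a dense graph contains few pairs with small
  codegree, and discarding the vertices that lie in many such pairs leaves pairwise
  connections by many paths of length four.\<close>

lemma many_paths_subset:
  fixes G :: "('a \<times> 'a) set" and \<tau> :: real
  assumes fin: "finite V" and G: "G \<subseteq> V \<times> V" and symm: "\<And>x y. (x, y) \<in> G \<Longrightarrow> (y, x) \<in> G"
    and \<tau>: "0 < \<tau>" and dense: "\<tau> * (real (card V))\<^sup>2 \<le> real (card G)"
  shows "\<exists>U\<subseteq>V. \<tau> * real (card V) / 4 \<le> real (card U) \<and>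
    (\<forall>x\<in>U. \<forall>y\<in>U. \<tau> ^ 5 * (real (card V)) ^ 3 / 4096 \<le>
       real (card {(a, z, b). a \<in> V \<and> z \<in> V \<and> b \<in> V \<and> (x, a) \<in> G \<and> (a, z) \<in> G \<and> (z, b) \<in> G \<and> (b, y) \<in> G}))"
proof (cases "V = {}")
  case True
  then show ?thesis by auto
next
  case False
  define n where "n = real (card V)"
  have n0: "n > 0" using False fin by (simp add: n_def card_gt_0_iff)
  define N where "N v = {x\<in>V. (v, x) \<in> G}" for v
  define cod where "cod x y = real (card {v\<in>V. (v, x) \<in> G \<and> (v, y) \<in> G})" for x y
  \<comment> \<open>The denominator 32 makes \<open>16 * \<epsilon> = \<tau>\<^sup>2 / 2\<close>, so
    that subtracting 16 times the number of bad pairs still leaves half of the lower bound for the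
    sum of squared degrees.\<close>
  define \<epsilon> where "\<epsilon> = \<tau>\<^sup>2 / 32"
  define Bad where "Bad = {(x, y). x \<in> V \<and> y \<in> V \<and> cod x y < \<epsilon> * n}"
  define bad where "bad v = {(x, y). x \<in> N v \<and> y \<in> N v \<and> cod x y < \<epsilon> * n}" for v
  have finN: "finite (N v)" for v using fin by (simp add: N_def)
  have finBad: "finite Bad"
    by (rule finite_subset[of _ "V \<times> V"]) (use fin in \<open>auto simp: Bad_def\<close>)
  have "real (card Bad) \<le> real (card (V \<times> V))"
    unfolding of_nat_le_iff by (rule card_mono) (use fin in \<open>auto simp: Bad_def\<close>)
  then have cBad: "real (card Bad) \<le> n\<^sup>2"
    by (simp add: card_cartesian_product n_def power2_eq_square)
  have "card (Sigma V N) = card G"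
    by (rule arg_cong[of _ _ card]) (use G in \<open>auto simp: N_def\<close>)
  then have sumN: "(\<Sum>v\<in>V. real (card (N v))) = real (card G)"
    using card_SigmaI[OF fin, of N] finN by (simp flip: of_nat_sum)
  have "(\<tau> * n\<^sup>2)\<^sup>2 \<le> (\<Sum>v\<in>V. 1 * real (card (N v)))\<^sup>2"
    using dense \<tau> by (intro power_mono) (auto simp: sumN n_def)
  also have "\<dots> \<le> (\<Sum>v\<in>V. 1\<^sup>2) * (\<Sum>v\<in>V. (real (card (N v)))\<^sup>2)"
    by (rule Cauchy_Schwarz_ineq_sum)
  finally have "\<tau>\<^sup>2 * n ^ 3 * n \<le> n * (\<Sum>v\<in>V. (real (card (N v)))\<^sup>2)"
    by (simp add: n_def power_mult_distrib power2_eq_square power3_eq_cube mult_ac)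
  then have sumN2: "\<tau>\<^sup>2 * n ^ 3 \<le> (\<Sum>v\<in>V. (real (card (N v)))\<^sup>2)"
    using n0 by (simp add: mult.commute)
  have cbad: "real (card (bad v)) = (\<Sum>(x, y)\<in>Bad. if (v, x) \<in> G \<and> (v, y) \<in> G then 1 else 0)" for v
  proof -
    have "bad v = {p\<in>Bad. (v, fst p) \<in> G \<and> (v, snd p) \<in> G}"
      by (auto simp: bad_def Bad_def N_def)
    then show ?thesis using card_conv_sum[OF finBad] by (simp add: case_prod_unfold)
  qed
  \<comment> \<open>Double counting: a pair in \<open>Bad\<close> lies in the neighbourhood of
    exactly \<open>cod x y\<close> vertices, fewer than \<open>\<epsilon> * n\<close>.\<close>
  have "(\<Sum>v\<in>V. real (card (bad v))) = (\<Sum>(x, y)\<in>Bad. \<Sum>v\<in>V. if (v, x) \<in> G \<and> (v, y) \<in> G then 1 else 0)"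
    unfolding cbad case_prod_unfold by (rule sum.swap)
  also have "\<dots> = (\<Sum>(x, y)\<in>Bad. cod x y)"
    by (simp add: cod_def card_conv_sum[OF fin] case_prod_unfold)
  also have "\<dots> \<le> (\<Sum>p\<in>Bad. \<epsilon> * n)"
    by (rule sum_mono) (auto simp: Bad_def)
  also have "\<dots> \<le> n\<^sup>2 * (\<epsilon> * n)"
    using cBad n0 by (simp add: \<epsilon>_def mult_right_mono)
  finally have sumbad: "(\<Sum>v\<in>V. real (card (bad v))) \<le> \<epsilon> * n ^ 3"
    by (simp add: power2_eq_square power3_eq_cube mult_ac)
  \<comment> \<open>The weight 16 ensures that a neighbourhood of size m contains at most m^2 / 16
    bad pairs. Hence at most m / 4 of its vertices have more than m / 4 bad partners; these are
    discarded below as \<open>R\<close>.\<close>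
  have "(\<Sum>v\<in>V. (real (card (N v)))\<^sup>2 - 16 * real (card (bad v))) \<ge> \<tau>\<^sup>2 * n ^ 3 - 16 * (\<epsilon> * n ^ 3)"
    unfolding sum_subtractf sum_distrib_left[symmetric] using sumN2 sumbad by linarith
  then have "(\<tau>\<^sup>2 * n\<^sup>2 / 2) * real (card V) \<le> (\<Sum>v\<in>V. (real (card (N v)))\<^sup>2 - 16 * real (card (bad v)))"
    by (simp add: \<epsilon>_def n_def[symmetric] power2_eq_square power3_eq_cube algebra_simps)
  then obtain v where v: "v \<in> V" "\<tau>\<^sup>2 * n\<^sup>2 / 2 \<le> (real (card (N v)))\<^sup>2 - 16 * real (card (bad v))"
    using exists_sum_le[OF False fin] by blast
  define m where "m = real (card (N v))"
  have m2: "\<tau>\<^sup>2 * n\<^sup>2 / 2 + 16 * real (card (bad v)) \<le> m\<^sup>2" using v by (simp add: m_def)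
  have m_ge: "\<tau> * n / 2 \<le> m"
  proof (rule power2_le_imp_le)
    have "(\<tau> * n / 2)\<^sup>2 = (\<tau>\<^sup>2 * n\<^sup>2 / 2) / 2" by (simp add: power2_eq_square)
    also have "\<dots> \<le> \<tau>\<^sup>2 * n\<^sup>2 / 2 + 16 * real (card (bad v))"
      using zero_le_mult_iff[of "\<tau>\<^sup>2" "n\<^sup>2"] by (simp add: field_simps)
    finally show "(\<tau> * n / 2)\<^sup>2 \<le> m\<^sup>2" using m2 by linarith
  qed (simp add: m_def)
  have m0: "m > 0" using m_ge \<tau> n0 by (smt (verit) divide_pos_pos mult_pos_pos)
  have bad_m: "16 * real (card (bad v)) \<le> m\<^sup>2"
    using m2 zero_le_mult_iff[of "\<tau>\<^sup>2" "n\<^sup>2"] by (smt (verit) divide_nonneg_nonneg zero_le_power2)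
  define D where "D x = {y\<in>N v. cod x y < \<epsilon> * n}" for x
  define R where "R = {x\<in>N v. m / 4 < real (card (D x))}"
  define U where "U = N v - R"
  have finD: "finite (D x)" for x using finN by (simp add: D_def)
  have finR: "finite R" using finN by (simp add: R_def)
  have "card (Sigma R D) \<le> card (bad v)"
  proof (rule card_mono)
    show "finite (bad v)"
      by (rule finite_subset[of _ "N v \<times> N v"]) (use finN in \<open>auto simp: bad_def\<close>)
  qed (auto simp: bad_def R_def D_def)
  then have "(\<Sum>x\<in>R. real (card (D x))) \<le> real (card (bad v))"
    using card_SigmaI[OF finR, of D] finD by (simp flip: of_nat_sum)
  moreover have "(\<Sum>x\<in>R. m / 4) \<le> (\<Sum>x\<in>R. real (card (D x)))"
    by (rule sum_mono) (auto simp: R_def)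
  ultimately have "real (card R) * (m / 4) \<le> m\<^sup>2 / 16"
    using bad_m unfolding sum_constant by linarith
  then have "real (card R) * m \<le> m / 4 * m" by (simp add: power2_eq_square mult_ac)
  then have cR: "real (card R) \<le> m / 4" using m0 mult_le_cancel_right_pos by blast
  have "card U = card (N v) - card R" "card R \<le> card (N v)"
    unfolding U_def by (rule card_Diff_subset[OF finR] card_mono[OF finN]; simp add: R_def)+
  then have cU: "real (card U) \<ge> 3 * m / 4" using cR by (simp add: m_def)
  show ?thesis
  proof (intro exI[of _ U] conjI ballI)
    show "U \<subseteq> V" by (auto simp: U_def N_def)
    show "\<tau> * real (card V) / 4 \<le> real (card U)" using cU m_ge m0 by (simp add: n_def)
  next
    fix x y assume xy: "x \<in> U" "y \<in> U"
    \<comment> \<open>\<open>W\<close> has at least m / 2 elements, none forming a bad pair with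
      \<open>x\<close> or \<open>y\<close>. Each \<open>z\<close> in it is the midpoint of at least
      \<open>(\<epsilon> * n)\<^sup>2\<close> paths x, a, z, b, y; with m / 2 \<ge> \<tau> n / 4
      this yields the constant 4 * 32^2 = 4096.\<close>
    define W where "W = N v - (D x \<union> D y)"
    have cD: "real (card (D x)) \<le> m / 4" "real (card (D y)) \<le> m / 4"
      using xy by (auto simp: U_def R_def)
    have sub: "D x \<union> D y \<subseteq> N v" by (auto simp: D_def)
    have "card W = card (N v) - card (D x \<union> D y)" "card (D x \<union> D y) \<le> card (N v)"
      unfolding W_def using card_Diff_subset[OF _ sub] card_mono[OF finN sub] finD by auto
    moreover have "card (D x \<union> D y) \<le> card (D x) + card (D y)" by (rule card_Un_le)
    ultimately have cW: "real (card W) \<ge> m / 2" using cD by (simp add: m_def)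
    define A where "A z = {v\<in>V. (v, x) \<in> G \<and> (v, z) \<in> G}" for z
    define B where "B z = {v\<in>V. (v, y) \<in> G \<and> (v, z) \<in> G}" for z
    have cAB: "real (card (A z)) \<ge> \<epsilon> * n" "real (card (B z)) \<ge> \<epsilon> * n" if "z \<in> W" for z
      using that by (auto simp: W_def D_def cod_def A_def B_def)
    define S where "S = (SIGMA z:W. A z \<times> B z)"
    have finW: "finite W" using finN by (simp add: W_def)
    have finAB: "finite (A z)" "finite (B z)" for z using fin by (auto simp: A_def B_def)
    let ?P = "{(a, z, b). a \<in> V \<and> z \<in> V \<and> b \<in> V \<and> (x, a) \<in> G \<and> (a, z) \<in> G \<and> (z, b) \<in> G \<and> (b, y) \<in> G}"
    have "\<tau> ^ 5 * (real (card V)) ^ 3 / 4096 = \<tau> * n / 2 / 2 * (\<epsilon> * n * (\<epsilon> * n))"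
      by (simp add: \<epsilon>_def n_def power_numeral_reduce)
    also have "\<dots> \<le> real (card W) * (\<epsilon> * n * (\<epsilon> * n))"
      by (rule mult_right_mono) (use cW m_ge in \<open>auto simp: \<epsilon>_def\<close>)
    also have "\<dots> = (\<Sum>z\<in>W. \<epsilon> * n * (\<epsilon> * n))" by simp
    also have "\<dots> \<le> (\<Sum>z\<in>W. real (card (A z)) * real (card (B z)))"
      using cAB n0 by (intro sum_mono mult_mono) (auto simp: \<epsilon>_def)
    also have "\<dots> = real (card S)"
      unfolding S_def using finAB by (subst card_SigmaI[OF finW]) (auto simp: card_cartesian_product)
    also have "card S \<le> card ?P"
    proof (rule card_inj_on_le)
      show "inj_on (\<lambda>(z, a, b). (a, z, b)) S" by (auto simp: inj_on_def)
      show "(\<lambda>(z, a, b). (a, z, b)) ` S \<subseteq> ?P"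
        using symm by (auto simp: S_def A_def B_def W_def N_def)
      show "finite ?P" by (rule finite_subset[of _ "V \<times> V \<times> V"]) (use fin in auto)
    qed
    finally show "\<tau> ^ 5 * (real (card V)) ^ 3 / 4096 \<le> real (card ?P)" by simp
  qed
qed


text \<open>Counting is with multiplicity, as \<open>\<phi>\<close> need not be injective.
  Cauchy--Schwarz bounds the number of representations of any difference by \<open>E\<close>, so
  \<open>E2\<close> places the additive energy within a factor \<open>K\<close> of its trivial upper
  bound. The quantity |V|^2 / E, a lower bound for the size of the image of \<open>V\<close>, takes
  the place of the size of the set in the conclusion.\<close>

lemma balog_szemeredi_gowers:
  fixes \<phi> :: "'v \<Rightarrow> 'g::ab_group_add" and K E :: real
  assumes fin: "finite V" and K: "K \<ge> 2"
    and E: "E = real (card {(u, v). u \<in> V \<and> v \<in> V \<and> \<phi> u = \<phi> v})"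
    and E2: "(real (card V))\<^sup>2 * E \<le> K * real (card {(p, q). p \<in> V \<times> V \<and> q \<in> V \<times> V \<and>
        \<phi> (fst p) - \<phi> (snd p) = \<phi> (fst q) - \<phi> (snd q)})"
  shows "\<exists>U\<subseteq>V. real (card V) \<le> K ^ 4 * real (card U) \<and>
    real (card (\<phi> ` U + uminus ` \<phi> ` U)) * E \<le> K ^ 52 * (real (card V))\<^sup>2"
proof (cases "V = {}")
  case True
  then show ?thesis by (intro exI[of _ "{}"]) (simp add: set_plus_def)
next
  case False
  define n where "n = real (card V)"
  have n0: "n > 0" using False fin by (simp add: n_def card_gt_0_iff)
  define f where "f p = \<phi> (fst p) - \<phi> (snd p)" for p
  define F where "F = f ` (V \<times> V)"
  define h where "h d = real (card {p \<in> V \<times> V. f p = d})" for d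
  have finF: "finite F" using fin by (simp add: F_def)
  have finE: "finite {(u, v). u \<in> V \<and> v \<in> V \<and> \<phi> u = \<phi> v}"
    by (rule finite_subset[of _ "V \<times> V"]) (use fin in auto)
  obtain v0 where "v0 \<in> V" using False by blast
  then have "{(u, v). u \<in> V \<and> v \<in> V \<and> \<phi> u = \<phi> v} \<noteq> {}" by blast
  then have E0: "E > 0" unfolding E using finE by (simp add: card_gt_0_iff)
  have hE: "h d \<le> E" for d
  proof (rule power2_le_imp_le)
    have "{p \<in> V \<times> V. f p = d} = {(x, y). x \<in> V \<and> y \<in> V \<and> \<phi> x = \<phi> y + d}"
      by (auto simp: f_def algebra_simps)
    then have "(card {p \<in> V \<times> V. f p = d})\<^sup>2 \<le> card {(u, v). u \<in> V \<and> v \<in> V \<and> \<phi> u = \<phi> v} *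
        card {(u, v). u \<in> V \<and> v \<in> V \<and> \<phi> u = \<phi> v}"
      using card_pairs_cauchy_schwarz[OF fin fin, of \<phi> "\<lambda>y. \<phi> y + d"] by simp
    then have "real ((card {p \<in> V \<times> V. f p = d})\<^sup>2) \<le> real (card {(u, v). u \<in> V \<and> v \<in> V \<and> \<phi> u = \<phi> v} *
        card {(u, v). u \<in> V \<and> v \<in> V \<and> \<phi> u = \<phi> v})"
      using of_nat_le_iff by blast
    then show "(h d)\<^sup>2 \<le> E\<^sup>2" by (simp add: h_def E power2_eq_square)
  qed (use E0 in simp)
  have sumh: "(\<Sum>d\<in>F. h d) = n\<^sup>2"
  proof -
    have "real (card (V \<times> V)) = (\<Sum>p\<in>V \<times> V. 1)" by simp
    also have "\<dots> = (\<Sum>d\<in>f ` (V \<times> V). \<Sum>p\<in>{p. p \<in> V \<times> V \<and> f p = d}. 1)"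
      by (rule sum.image_gen) (use fin in simp)
    finally show ?thesis by (simp add: h_def F_def n_def card_cartesian_product power2_eq_square)
  qed
  have "(\<Sum>d\<in>F. (h d)\<^sup>2) = real (card {(p, q). p \<in> V \<times> V \<and> q \<in> V \<times> V \<and> f p = f q})"
    using fin by (subst card_fibre_pairs) (simp_all add: h_def F_def power2_eq_square)
  then have sumh2: "n\<^sup>2 * E \<le> K * (\<Sum>d\<in>F. (h d)\<^sup>2)" using E2 by (simp add: f_def n_def)
  \<comment> \<open>Differences with fewer than E / (2 K) representations contribute at most n^2 E /
    (2 K) to the second moment, half of what \<open>E2\<close> guarantees. The popular ones
    therefore account for at least n^2 / (2 K) pairs.\<close>
  define H where "H = {d\<in>F. E / (2 * K) \<le> h d}"
  have HF: "H \<subseteq> F" and finH: "finite H" using finF by (auto simp: H_def)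
  have h0: "h d \<ge> 0" for d by (simp add: h_def)
  have "(\<Sum>d\<in>F. (h d)\<^sup>2) = (\<Sum>d\<in>F - H. (h d)\<^sup>2) + (\<Sum>d\<in>H. (h d)\<^sup>2)"
    by (rule sum.subset_diff[OF HF finF])
  also have "(\<Sum>d\<in>F - H. (h d)\<^sup>2) \<le> (\<Sum>d\<in>F - H. E / (2 * K) * h d)"
    unfolding power2_eq_square by (intro sum_mono mult_right_mono) (auto simp: H_def h0)
  also have "\<dots> \<le> (\<Sum>d\<in>F. E / (2 * K) * h d)"
    by (rule sum_mono2) (use finF E0 K h0 in auto)
  also have "\<dots> = E / (2 * K) * n\<^sup>2" by (simp only: sumh sum_distrib_left[symmetric])
  also have "(\<Sum>d\<in>H. (h d)\<^sup>2) \<le> (\<Sum>d\<in>H. E * h d)"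
    unfolding power2_eq_square by (intro sum_mono mult_right_mono h0 hE)
  also have "\<dots> = E * (\<Sum>d\<in>H. h d)" by (simp add: sum_distrib_left)
  finally have "(\<Sum>d\<in>F. (h d)\<^sup>2) \<le> E / (2 * K) * n\<^sup>2 + E * (\<Sum>d\<in>H. h d)" by simp
  then have "K * (\<Sum>d\<in>F. (h d)\<^sup>2) \<le> K * (E / (2 * K) * n\<^sup>2 + E * (\<Sum>d\<in>H. h d))"
    using K by (intro mult_left_mono) auto
  then have "n\<^sup>2 * E \<le> K * (E / (2 * K) * n\<^sup>2 + E * (\<Sum>d\<in>H. h d))"
    using sumh2 by linarith
  also have "\<dots> = E * (n\<^sup>2 / 2 + K * (\<Sum>d\<in>H. h d))" using K by (simp add: field_simps)
  finally have "n\<^sup>2 \<le> n\<^sup>2 / 2 + K * (\<Sum>d\<in>H. h d)" using E0 by (simp add: mult.commute)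
  then have sumH: "1 / (2 * K) * n\<^sup>2 \<le> (\<Sum>d\<in>H. h d)" using K by (simp add: field_simps)
  have "real (card H) * (E / (2 * K)) \<le> (\<Sum>d\<in>H. h d)"
    using sum_mono[of H "\<lambda>_. E / (2 * K)" h] by (simp add: H_def)
  also have "\<dots> \<le> n\<^sup>2" unfolding sumh[symmetric] by (rule sum_mono2) (use finF HF h0 in auto)
  finally have cH: "real (card H) \<le> 2 * K * n\<^sup>2 / E" using K E0 by (simp add: field_simps)
  have Hsym: "- d \<in> H" if "d \<in> H" for d
  proof -
    have "h (- d) = h d"
      unfolding h_def of_nat_eq_iff
      by (rule bij_betw_same_card[of "\<lambda>(u, v). (v, u)"], rule bij_betwI[where g = "\<lambda>(u, v). (v, u)"])
        (auto simp: f_def, (metis minus_diff_eq minus_minus)+)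
    moreover have "- d \<in> F"
      using that by (force simp: H_def F_def f_def image_iff)
    ultimately show ?thesis using that by (simp add: H_def)
  qed
  \<comment> \<open>Edges join points with a popular difference, so a path of length four from x to
    y writes \<phi> x - \<phi> y as a sum of four elements of \<open>H\<close>.\<close>
  define G where "G = {(u, v). u \<in> V \<and> v \<in> V \<and> \<phi> u - \<phi> v \<in> H}"
  have "G = (\<Union>d\<in>H. {p \<in> V \<times> V. f p = d})" by (auto simp: G_def f_def)
  also have "card \<dots> = (\<Sum>d\<in>H. card {p \<in> V \<times> V. f p = d})"
    by (rule card_UN_disjoint) (use finH fin in auto)
  finally have "real (card G) = (\<Sum>d\<in>H. h d)" by (simp add: h_def)
  then have dense: "1 / (2 * K) * (real (card V))\<^sup>2 \<le> real (card G)"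
    using sumH by (simp add: n_def)
  have Gsym: "(y, x) \<in> G" if "(x, y) \<in> G" for x y
    using that Hsym[of "\<phi> x - \<phi> y"] by (auto simp: G_def)
  define P where "P x y = {(a, z, b). a \<in> V \<and> z \<in> V \<and> b \<in> V \<and> (x, a) \<in> G \<and> (a, z) \<in> G \<and> (z, b) \<in> G \<and> (b, y) \<in> G}"
    for x y
  have GV: "G \<subseteq> V \<times> V" by (auto simp: G_def)
  have "1 / (2 * K) > 0" using K by simp
  from many_paths_subset[OF fin GV Gsym this dense]
  obtain U where U: "U \<subseteq> V" "1 / (2 * K) * n / 4 \<le> real (card U)"
    and paths: "\<And>x y. x \<in> U \<Longrightarrow> y \<in> U \<Longrightarrow> (1 / (2 * K)) ^ 5 * n ^ 3 / 4096 \<le> real (card (P x y))"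
    unfolding n_def[symmetric] P_def[symmetric] by blast
  \<comment> \<open>Only the images of the inner vertices matter for the four differences along a
    path, so distinct images have to be counted. Coincidences of \<open>\<psi>\<close> number at
    most E^3, hence by Cauchy--Schwarz many images remain.\<close>
  define \<psi> where "\<psi> = (\<lambda>(a, z, b). (\<phi> a, \<phi> z, \<phi> b))"
  have finP: "finite (P x y)" for x y
    by (rule finite_subset[of _ "V \<times> V \<times> V"]) (use fin in \<open>auto simp: P_def\<close>)
  have K2: "2 ^ j \<le> K ^ j" for j using K by (intro power_mono) auto
  have images: "n ^ 6 \<le> K ^ 44 * E ^ 3 * real (card (\<psi> ` P x y))" if xy: "x \<in> U" "y \<in> U" for x y
  proof -
    let ?Q = "{(u, v). u \<in> V \<and> v \<in> V \<and> \<phi> u = \<phi> v}"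
    have "card {(p, q). p \<in> P x y \<and> q \<in> P x y \<and> \<psi> p = \<psi> q} \<le> card (?Q \<times> ?Q \<times> ?Q)"
    proof (rule card_inj_on_le)
      let ?g = "\<lambda>((a, z, b), (a', z', b')). ((a, a'), (z, z'), (b, b'))"
      show "inj_on ?g {(p, q). p \<in> P x y \<and> q \<in> P x y \<and> \<psi> p = \<psi> q}"
        by (auto simp: inj_on_def)
      show "?g ` {(p, q). p \<in> P x y \<and> q \<in> P x y \<and> \<psi> p = \<psi> q} \<subseteq> ?Q \<times> ?Q \<times> ?Q"
        by (auto simp: P_def \<psi>_def)
      show "finite (?Q \<times> ?Q \<times> ?Q)" using finE by simp
    qed
    then have cpairs: "real (card {(p, q). p \<in> P x y \<and> q \<in> P x y \<and> \<psi> p = \<psi> q}) \<le> E ^ 3"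
      unfolding E card_cartesian_product power3_eq_cube
      by (simp add: mult.assoc flip: of_nat_mult)
    have "real ((card (P x y))\<^sup>2) \<le> real (card {(p, q). p \<in> P x y \<and> q \<in> P x y \<and> \<psi> p = \<psi> q} * card (\<psi> ` P x y))"
      using card_sq_le_card_image[OF finP, of x y \<psi>] of_nat_le_iff by blast
    also have "\<dots> \<le> E ^ 3 * real (card (\<psi> ` P x y))"
      unfolding of_nat_mult by (rule mult_right_mono[OF cpairs]) simp
    finally have sq: "(real (card (P x y)))\<^sup>2 \<le> E ^ 3 * real (card (\<psi> ` P x y))" by simp
    \<comment> \<open>Here 2^5 * 4096 = 2^17; since \<open>K \<ge> 2\<close>, powers of 2 are
      absorbed into powers of \<open>K\<close>.\<close>
    have "n ^ 3 = 2 ^ 17 * K ^ 5 * ((1 / (2 * K)) ^ 5 * n ^ 3 / 4096)"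
      using K by (simp add: power_divide power_mult_distrib)
    also have "\<dots> \<le> K ^ 17 * K ^ 5 * real (card (P x y))"
      using paths[OF xy] K K2[of 17] n0 by (intro mult_mono) auto
    finally have "n ^ 3 \<le> K ^ 22 * real (card (P x y))" by (simp flip: power_add)
    then have "(n ^ 3)\<^sup>2 \<le> (K ^ 22 * real (card (P x y)))\<^sup>2" using n0 by (intro power_mono) auto
    then have "n ^ 6 \<le> K ^ 44 * (real (card (P x y)))\<^sup>2"
      by (simp add: power_mult_distrib flip: power_mult)
    also have "\<dots> \<le> K ^ 44 * (E ^ 3 * real (card (\<psi> ` P x y)))"
      using sq K by (intro mult_left_mono) auto
    finally show ?thesis by (simp add: mult.assoc)
  qed
  define D where "D = \<phi> ` U + uminus ` \<phi> ` U"
  have finU: "finite U" using U fin finite_subset by blast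
  have finD: "finite D" using finU by (simp add: D_def finite_set_plus)
  have "\<forall>d\<in>D. \<exists>p. fst p \<in> U \<and> snd p \<in> U \<and> d = \<phi> (fst p) - \<phi> (snd p)"
    by (force simp: D_def set_plus_def)
  then obtain p where p: "\<And>d. d \<in> D \<Longrightarrow> fst (p d) \<in> U \<and> snd (p d) \<in> U \<and> d = \<phi> (fst (p d)) - \<phi> (snd (p d))"
    by metis
  define S where "S = (SIGMA d:D. \<psi> ` P (fst (p d)) (snd (p d)))"
  \<comment> \<open>The four entries telescope to \<open>d\<close>. They thus recover
    \<open>d\<close>, hence the endpoints fixed by \<open>p\<close>, and then \<open>a\<close>,
    \<open>z\<close>, \<open>b\<close> in turn.\<close>
  define g where "g = (\<lambda>(d, (a, z, b)). (\<phi> (fst (p d)) - a, a - z, z - b, b - \<phi> (snd (p d))))"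
  have "card S \<le> card (H \<times> H \<times> H \<times> H)"
  proof (rule card_inj_on_le)
    show "inj_on g S"
    proof (rule inj_onI)
      fix q q' assume q: "q \<in> S" "q' \<in> S" "g q = g q'"
      obtain d a z b d' a' z' b' where e: "q = (d, a, z, b)" "q' = (d', a', z', b')"
        by (metis prod.exhaust)
      have eqs: "\<phi> (fst (p d)) - a = \<phi> (fst (p d')) - a'" "a - z = a' - z'" "z - b = z' - b'"
        "b - \<phi> (snd (p d)) = b' - \<phi> (snd (p d'))"
        using q(3) by (auto simp: g_def e)
      have "d = (\<phi> (fst (p d)) - a) + (a - z) + (z - b) + (b - \<phi> (snd (p d)))"
        using p[of d] q(1) by (simp add: S_def e)
      also have "\<dots> = (\<phi> (fst (p d')) - a') + (a' - z') + (z' - b') + (b' - \<phi> (snd (p d')))"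
        by (simp only: eqs)
      also have "\<dots> = d'" using p[of d'] q(2) by (simp add: S_def e)
      finally have "d = d'" .
      moreover from this have "a = a'" using eqs by simp
      moreover from this have "z = z'" using eqs by simp
      moreover from this have "b = b'" using eqs by simp
      ultimately show "q = q'" by (simp add: e)
    qed
    show "g ` S \<subseteq> H \<times> H \<times> H \<times> H"
      by (auto simp: S_def g_def \<psi>_def P_def G_def)
    show "finite (H \<times> H \<times> H \<times> H)" using finH by simp
  qed
  then have "real (card S) \<le> real (card H) ^ 4"
    by (simp add: card_cartesian_product power_numeral_reduce flip: of_nat_mult)
  also have "\<dots> \<le> (2 * K * n\<^sup>2 / E) ^ 4" using cH by (intro power_mono) auto
  finally have cS: "real (card S) \<le> (2 * K * n\<^sup>2 / E) ^ 4" .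
  have cS': "real (card S) = (\<Sum>d\<in>D. real (card (\<psi> ` P (fst (p d)) (snd (p d)))))"
    unfolding S_def using finP by (subst card_SigmaI[OF finD]) auto
  \<comment> \<open>Every \<open>d\<close> in \<open>D\<close> carries at least n^6 / (K^44 E^3)
    elements of \<open>S\<close>, whereas \<open>S\<close> embeds in the fourth power of
    \<open>H\<close>. Comparing the two counts bounds |D|.\<close>
  have "real (card D) * n ^ 6 = (\<Sum>d\<in>D. n ^ 6)" by simp
  also have "\<dots> \<le> (\<Sum>d\<in>D. K ^ 44 * E ^ 3 * real (card (\<psi> ` P (fst (p d)) (snd (p d)))))"
    by (rule sum_mono) (use images p in blast)
  also have "\<dots> = K ^ 44 * E ^ 3 * real (card S)" by (simp add: cS' sum_distrib_left)
  also have "\<dots> \<le> K ^ 44 * E ^ 3 * (2 * K * n\<^sup>2 / E) ^ 4"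
    using cS K E0 by (intro mult_left_mono) auto
  also have "\<dots> = 2 ^ 4 * K ^ 48 * n\<^sup>2 / E * n ^ 6"
  proof -
    have "E ^ 3 / E ^ 4 = 1 / E" using E0 by (simp add: power_numeral_reduce)
    moreover have "K ^ 44 * K ^ 4 = K ^ 48" by (simp flip: power_add)
    moreover have "(n\<^sup>2) ^ 4 = n\<^sup>2 * n ^ 6" by (simp flip: power_add power_mult)
    moreover have "K ^ 44 * E ^ 3 * (2 * K * n\<^sup>2 / E) ^ 4
        = 2 ^ 4 * (K ^ 44 * K ^ 4) * (n\<^sup>2) ^ 4 * (E ^ 3 / E ^ 4)"
      by (simp only: power_mult_distrib power_divide) (simp only: divide_inverse mult_ac)
    ultimately show ?thesis by simp
  qed
  finally have "real (card D) \<le> 2 ^ 4 * K ^ 48 * n\<^sup>2 / E"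
    by (rule mult_right_le_imp_le) (use n0 in simp)
  then have "real (card D) * E \<le> 2 ^ 4 * K ^ 48 * n\<^sup>2" using E0 by (simp add: field_simps)
  also have "\<dots> \<le> K ^ 4 * K ^ 48 * n\<^sup>2"
    using K2[of 4] K by (intro mult_right_mono) auto
  finally have "real (card D) * E \<le> K ^ 52 * n\<^sup>2" by (simp flip: power_add)
  moreover have "n \<le> K ^ 4 * real (card U)"
  proof -
    have "n \<le> 2 ^ 3 * K * real (card U)" using U(2) K by (simp add: field_simps)
    also have "\<dots> \<le> K ^ 3 * K * real (card U)" using K2[of 3] K by (intro mult_right_mono) auto
    finally show ?thesis by (simp add: power_numeral_reduce mult_ac)
  qed
  ultimately show ?thesis using U(1) by (auto simp: D_def n_def)
qed

section \<open>Energies and structured subsets\<close>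

lemma card_le_plus:
  fixes S T :: "'a::cancel_comm_monoid_add set"
  assumes "finite S" "finite T" "T \<noteq> {}"
  shows "card S \<le> card (S + T)"
proof -
  obtain c where "c \<in> T" using assms by blast
  then have "S + {c} \<subseteq> S + T" by (intro set_plus_mono2) auto
  then have "card (S + {c}) \<le> card (S + T)"
    using assms by (intro card_mono finite_set_plus)
  then show ?thesis by (simp add: card_translate)
qed

lemma uminus_set_plus:
  fixes S T :: "'a::ab_group_add set"
  shows "uminus ` (S + T) = uminus ` S + uminus ` T"
  by (rule image_set_plus) simp

lemma uminus_nsum:
  fixes S :: "'a::ab_group_add set"
  shows "uminus ` nsum n S = nsum n (uminus ` S)"
  by (rule nsum_image) auto

section \<open>Energies of tuples\<close>

definition tuples :: "'a set \<Rightarrow> nat \<Rightarrow> 'a list set" where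
  "tuples A n = {xs. set xs \<subseteq> A \<and> length xs = n}"

definition list_value :: "('a \<Rightarrow> 'b::comm_monoid_add) \<Rightarrow> 'a list \<Rightarrow> 'b" where
  "list_value \<gamma> xs = sum_list (map \<gamma> xs)"

text \<open>For \<open>\<gamma>\<close> the moment curve this is the mean value \<open>J\<close>.
  Lists allow an equation to be split into head and tail or into two halves.\<close>

definition energy :: "('a \<Rightarrow> 'b::comm_monoid_add) \<Rightarrow> 'a set \<Rightarrow> nat \<Rightarrow> nat" where
  "energy \<gamma> A n = card {(x, y). x \<in> tuples A n \<and> y \<in> tuples A n \<and> list_value \<gamma> x = list_value \<gamma> y}"

lemma finite_tuples [simp]: "finite A \<Longrightarrow> finite (tuples A n)"
  by (simp add: tuples_def finite_lists_length_eq)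

lemma card_tuples: "finite A \<Longrightarrow> card (tuples A n) = card A ^ n"
  by (simp add: tuples_def card_lists_length_eq)

lemma list_value_simps [simp]:
  "list_value \<gamma> [] = 0"
  "list_value \<gamma> (x # xs) = \<gamma> x + list_value \<gamma> xs"
  "list_value \<gamma> (xs @ ys) = list_value \<gamma> xs + list_value \<gamma> ys"
  by (simp_all add: list_value_def)

lemma tuples_Suc: "tuples A (Suc n) = (\<lambda>(a, xs). a # xs) ` (A \<times> tuples A n)"
  by (auto simp: tuples_def length_Suc_conv image_iff)

lemma list_value_image: "list_value \<gamma> ` tuples A n = nsum n (\<gamma> ` A)"
proof (induction n)
  case 0
  then show ?case by (auto simp: tuples_def image_iff intro: exI[of _ "[]"])
next
  case (Suc n)
  have "list_value \<gamma> ` tuples A (Suc n) = \<gamma> ` A + list_value \<gamma> ` tuples A n"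
    unfolding tuples_Suc image_image by (force simp: set_plus_def)
  then show ?case by (simp add: Suc)
qed

lemma energy_mono:
  assumes "finite B" "A \<subseteq> B"
  shows "energy \<gamma> A n \<le> energy \<gamma> B n"
  unfolding energy_def
proof (rule card_mono)
  show "finite {(x, y). x \<in> tuples B n \<and> y \<in> tuples B n \<and> list_value \<gamma> x = list_value \<gamma> y}"
    by (rule finite_subset[of _ "tuples B n \<times> tuples B n"]) (use assms in auto)
qed (use assms in \<open>auto simp: tuples_def\<close>)

lemma energy_pos:
  assumes "finite A" "A \<noteq> {}"
  shows "energy \<gamma> A n > 0"
proof -
  obtain a where "a \<in> A" using assms by blast
  then have "replicate n a \<in> tuples A n" by (auto simp: tuples_def)
  then have "{(x, y). x \<in> tuples A n \<and> y \<in> tuples A n \<and> list_value \<gamma> x = list_value \<gamma> y} \<noteq> {}"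
    by blast
  moreover have "finite {(x, y). x \<in> tuples A n \<and> y \<in> tuples A n \<and> list_value \<gamma> x = list_value \<gamma> y}"
    by (rule finite_subset[of _ "tuples A n \<times> tuples A n"]) (use assms in auto)
  ultimately show ?thesis by (simp add: energy_def card_gt_0_iff)
qed

lemma card_power_le_energy_nsum:
  assumes "finite A"
  shows "card A ^ (2 * n) \<le> energy \<gamma> A n * card (nsum n (\<gamma> ` A))"
  using card_sq_le_card_image[of "tuples A n" "list_value \<gamma>"] assms
  by (simp add: card_tuples energy_def list_value_image mult.commute flip: power_mult)

text \<open>Once the first entries a and b are fixed, the tails solve the equation shifted by
  \<gamma> a - \<gamma> b. By Cauchy--Schwarz a shifted equation has at most as many solutions as
  the unshifted one.\<close>

lemma energy_Suc:
  fixes \<gamma> :: "'a \<Rightarrow> 'b::ab_group_add"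
  assumes "finite A"
  shows "energy \<gamma> A (Suc n) \<le> (card A)\<^sup>2 * energy \<gamma> A n"
proof -
  define S where "S a b = {(x, y). x \<in> tuples A n \<and> y \<in> tuples A n \<and> \<gamma> a + list_value \<gamma> x = \<gamma> b + list_value \<gamma> y}" for a b
  have finS: "finite (S a b)" for a b
    by (rule finite_subset[of _ "tuples A n \<times> tuples A n"]) (use assms in \<open>auto simp: S_def\<close>)
  have S: "card (S a b) \<le> energy \<gamma> A n" for a b
  proof (rule power2_le_imp_le)
    show "(card (S a b))\<^sup>2 \<le> (energy \<gamma> A n)\<^sup>2"
      using card_pairs_cauchy_schwarz[of "tuples A n" "tuples A n"
          "\<lambda>x. \<gamma> a + list_value \<gamma> x" "\<lambda>x. \<gamma> b + list_value \<gamma> x"] assms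
      by (simp add: S_def energy_def power2_eq_square)
  qed simp
  define T where "T = (SIGMA p:A \<times> A. S (fst p) (snd p))"
  have "energy \<gamma> A (Suc n) \<le> card T"
    unfolding energy_def
  proof (rule card_inj_on_le)
    let ?f = "\<lambda>(x, y). ((hd x, hd y), (tl x, tl y))"
    show "inj_on ?f {(x, y). x \<in> tuples A (Suc n) \<and> y \<in> tuples A (Suc n) \<and> list_value \<gamma> x = list_value \<gamma> y}"
      by (auto simp: inj_on_def tuples_Suc)
    show "?f ` {(x, y). x \<in> tuples A (Suc n) \<and> y \<in> tuples A (Suc n) \<and> list_value \<gamma> x = list_value \<gamma> y} \<subseteq> T"
      by (auto simp: T_def S_def tuples_Suc)
    show "finite T" using assms finS by (simp add: T_def)
  qed
  also have "card T = (\<Sum>p\<in>A \<times> A. card (S (fst p) (snd p)))"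
    unfolding T_def by (rule card_SigmaI) (use assms finS in auto)
  also have "\<dots> \<le> (\<Sum>p\<in>A \<times> A. energy \<gamma> A n)"
    by (rule sum_mono) (rule S)
  finally show ?thesis by (simp add: card_cartesian_product power2_eq_square)
qed

lemma energy_add:
  fixes \<gamma> :: "'a \<Rightarrow> 'b::ab_group_add"
  assumes "finite A"
  shows "energy \<gamma> A (m + n) \<le> card A ^ (2 * m) * energy \<gamma> A n"
proof (induction m)
  case (Suc m)
  have "energy \<gamma> A (Suc m + n) \<le> (card A)\<^sup>2 * energy \<gamma> A (m + n)"
    using energy_Suc[OF assms] by simp
  also have "\<dots> \<le> (card A)\<^sup>2 * (card A ^ (2 * m) * energy \<gamma> A n)"
    by (rule mult_left_mono[OF Suc]) simp
  finally show ?case by (simp add: power2_eq_square mult_ac)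
qed simp

text \<open>Cutting both lists in the middle and moving two halves across the equation produces an
  equality of two differences, the form to which \<open>balog_szemeredi_gowers\<close>
  applies.\<close>

lemma energy_double:
  fixes \<gamma> :: "'a \<Rightarrow> 'b::ab_group_add"
  assumes "finite A"
  shows "energy \<gamma> A (2 * n) \<le> card {(p, q). p \<in> tuples A n \<times> tuples A n \<and> q \<in> tuples A n \<times> tuples A n \<and>
      list_value \<gamma> (fst p) - list_value \<gamma> (snd p) = list_value \<gamma> (fst q) - list_value \<gamma> (snd q)}"
    (is "_ \<le> card ?S")
  unfolding energy_def
proof (rule card_inj_on_le)
  let ?T = "{(x, y). x \<in> tuples A (2 * n) \<and> y \<in> tuples A (2 * n) \<and> list_value \<gamma> x = list_value \<gamma> y}"
  let ?f = "\<lambda>(x, y). ((take n x, take n y), (drop n y, drop n x))"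
  show "inj_on ?f ?T"
    by (auto simp: inj_on_def) (metis append_take_drop_id)+
  show "?f ` ?T \<subseteq> ?S"
  proof -
    have "list_value \<gamma> (take n x) - list_value \<gamma> (take n y) = list_value \<gamma> (drop n y) - list_value \<gamma> (drop n x)"
      if "list_value \<gamma> x = list_value \<gamma> y" for x y
    proof -
      have "list_value \<gamma> (take n x) + list_value \<gamma> (drop n x) = list_value \<gamma> (take n y) + list_value \<gamma> (drop n y)"
        using that by (simp flip: list_value_simps(3))
      then show ?thesis by (simp add: algebra_simps)
    qed
    then show ?thesis
      by (auto simp: tuples_def dest: in_set_takeD in_set_dropD)
  qed
  show "finite ?S"
    by (rule finite_subset[of _ "(tuples A n \<times> tuples A n) \<times> (tuples A n \<times> tuples A n)"]) (use assms in auto)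
qed

text \<open>Pluennecke's inequality with summands from -P controls X - m P only for some subset X of
  P. Ruzsa's triangle inequality through X replaces X by m P, which squares the factor K^m.\<close>

lemma nsum_difference_bound:
  fixes P :: "'a::ab_group_add set" and K :: real
  assumes fin: "finite P" and ne: "P \<noteq> {}" and K: "real (card (P + uminus ` P)) \<le> K * real (card P)"
  shows "real (card (nsum m P + uminus ` nsum m P)) \<le> K ^ (2 * m) * real (card P)"
proof -
  obtain X where X: "X \<subseteq> P" "X \<noteq> {}"
    and bd: "real (card (X + nsum m (uminus ` P))) \<le> K ^ m * real (card X)"
    using pluennecke[OF fin ne _ K] fin by auto
  have finX: "finite X" using X fin finite_subset by blast
  have X0: "real (card X) > 0" using X finX by (simp add: card_gt_0_iff)
  let ?S = "nsum m P"
  have "nsum m P + uminus ` X = uminus ` (X + uminus ` ?S)"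
    by (simp add: uminus_set_plus image_image add.commute)
  then have eq: "card (?S + uminus ` X) = card (X + uminus ` ?S)" by simp
  have "card (?S + uminus ` ?S) * card X \<le> card (?S + uminus ` X) * card (X + uminus ` ?S)"
    by (rule ruzsa_triangle) (use fin finX in auto)
  then have "real (card (?S + uminus ` ?S)) * real (card X) \<le> (real (card (X + uminus ` ?S)))\<^sup>2"
    unfolding eq by (simp add: power2_eq_square flip: of_nat_mult)
  also have "\<dots> \<le> (K ^ m * real (card X))\<^sup>2"
    using bd by (intro power_mono) (auto simp: uminus_nsum)
  also have "\<dots> = K ^ (2 * m) * real (card X) * real (card X)"
    by (simp add: power2_eq_square power_mult mult_ac power_mult_distrib)
  finally have "real (card (?S + uminus ` ?S)) \<le> K ^ (2 * m) * real (card X)"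
    by (rule mult_right_le_imp_le) (rule X0)
  also have "\<dots> \<le> K ^ (2 * m) * real (card P)"
    using X fin by (intro mult_left_mono) (auto intro: card_mono simp: power_mult)
  finally show ?thesis .
qed

text \<open>The sum \<open>Z + Y\<close> contains disjoint translates of the largest fibre of \<open>Y\<close>, one for each
  point of \<open>\<pi> ` Z\<close>.\<close>

lemma card_image_hom_le:
  fixes \<pi> :: "'a::ab_group_add \<Rightarrow> 'b::ab_group_add"
  assumes hom: "\<And>x y. \<pi> (x + y) = \<pi> x + \<pi> y" and fin: "finite Z" "finite Y" and "Y \<noteq> {}"
  shows "card (\<pi> ` Z) * card Y \<le> card (Z + Y) * card (\<pi> ` Y)"
proof -
  define F where "F p = {y\<in>Y. \<pi> y = p}" for p
  have finF: "finite (F p)" for p using fin by (simp add: F_def)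
  have disj: "card (\<pi> ` Z) * card (F p) \<le> card (Z + Y)" for p
  proof -
    have "\<forall>q\<in>\<pi> ` Z. \<exists>z. z \<in> Z \<and> \<pi> z = q" by auto
    then obtain s where s: "\<And>q. q \<in> \<pi> ` Z \<Longrightarrow> s q \<in> Z \<and> \<pi> (s q) = q" by metis
    have "card (\<pi> ` Z \<times> F p) \<le> card (Z + Y)"
    proof (rule card_inj_on_le)
      show "inj_on (\<lambda>(q, y). s q + y) (\<pi> ` Z \<times> F p)"
      proof (rule inj_onI, clarify)
        fix z y z' y' assume a: "z \<in> Z" "z' \<in> Z" "y \<in> F p" "y' \<in> F p" "s (\<pi> z) + y = s (\<pi> z') + y'"
        have "\<pi> (s (\<pi> z)) + \<pi> y = \<pi> (s (\<pi> z')) + \<pi> y'" using a(5) by (metis hom)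
        then have "\<pi> z = \<pi> z'" using s a by (simp add: F_def)
        then show "\<pi> z = \<pi> z' \<and> y = y'" using a by simp
      qed
      show "(\<lambda>(q, y). s q + y) ` (\<pi> ` Z \<times> F p) \<subseteq> Z + Y"
        using s by (auto simp: F_def intro!: set_plus_intro)
    qed (use fin finite_set_plus in auto)
    then show ?thesis by (simp add: card_cartesian_product)
  qed
  have "card Y = card (\<Union>p\<in>\<pi> ` Y. F p)" by (rule arg_cong[of _ _ card]) (auto simp: F_def)
  also have "\<dots> = (\<Sum>p\<in>\<pi> ` Y. card (F p))"
    by (rule card_UN_disjoint) (use fin in \<open>auto simp: F_def\<close>)
  finally have "card (\<pi> ` Z) * card Y = (\<Sum>p\<in>\<pi> ` Y. card (\<pi> ` Z) * card (F p))"
    by (simp add: sum_distrib_left)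
  also have "\<dots> \<le> (\<Sum>p\<in>\<pi> ` Y. card (Z + Y))" by (rule sum_mono) (rule disj)
  finally show ?thesis by (simp add: mult.commute)
qed

text \<open>Averaging over the tails \<open>w\<close> leads from a dense set of tuples to a dense
  subset of \<open>A\<close>.\<close>

lemma exists_dense_fibre:
  fixes \<kappa> :: real
  assumes fin: "finite A" and U: "U \<subseteq> tuples A (Suc n)" "U \<noteq> {}"
    and dense: "real (card A) ^ Suc n \<le> \<kappa> * real (card U)"
  shows "\<exists>w. real (card A) \<le> \<kappa> * real (card {a\<in>A. a # w \<in> U})"
proof -
  define F where "F w = {a\<in>A. a # w \<in> U}" for w
  have finF: "finite (F w)" for w using fin by (simp add: F_def)
  have A0: "A \<noteq> {}" using U by (auto simp: tuples_Suc)
  then have T0: "tuples A n \<noteq> {}"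
    using fin card_tuples[of A n] by (metis card_0_eq card_eq_0_iff power_eq_0_iff card.empty)
  have "U \<subseteq> (\<lambda>(w, a). a # w) ` Sigma (tuples A n) F"
    using U(1) by (force simp: F_def tuples_Suc)
  then have "card U \<le> card (Sigma (tuples A n) F)"
    using fin finF by (meson card_image_le card_mono finite_SigmaI finite_imageI finite_tuples order_trans)
  also have "\<dots> = (\<Sum>w\<in>tuples A n. card (F w))"
    using fin finF by simp
  finally have "real (card U) \<le> (\<Sum>w\<in>tuples A n. real (card (F w)))"
    by (simp flip: of_nat_sum)
  moreover have "\<kappa> > 0"
  proof (rule ccontr)
    assume "\<not> \<kappa> > 0"
    then have "\<kappa> * real (card U) \<le> 0" by (simp add: mult_nonpos_nonneg)
    moreover have "real (card A) ^ Suc n > 0" using A0 fin by (simp add: card_gt_0_iff)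
    ultimately show False using dense by linarith
  qed
  ultimately have "\<kappa> * real (card U) \<le> \<kappa> * (\<Sum>w\<in>tuples A n. real (card (F w)))" by simp
  then have "real (card A) * real (card (tuples A n)) \<le> (\<Sum>w\<in>tuples A n. \<kappa> * real (card (F w)))"
    using dense fin by (simp add: card_tuples sum_distrib_left)
  then show ?thesis
    using exists_sum_le[OF T0, of "real (card A)"] fin by (auto simp: F_def)
qed

text \<open>The Balog--Szemeredi--Gowers theorem for t-tuples gives a dense set of tuples whose
  values form a set P of small doubling. Fixing all entries but the first yields \<open>B\<close>
  with a translate of \<gamma> B inside P. With n = |A|^t and E the t-fold energy, all sizes are
  measured against n^2 / E: iterated difference sets of \<gamma> B from above, and the t-fold sumset
  of a dense \<open>D\<close> from below. The resulting comparison is then carried over to the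
  images under \<open>\<pi>\<close>.\<close>

lemma structured_subset:
  fixes \<gamma> :: "'a \<Rightarrow> 'g::ab_group_add" and \<pi> :: "'g \<Rightarrow> 'h::ab_group_add" and K :: real
  assumes fin: "finite A" and ne: "A \<noteq> {}" and K: "K \<ge> 2" and t: "t \<ge> 1"
    and hom: "\<And>x y. \<pi> (x + y) = \<pi> x + \<pi> y"
    and large: "real (card A) ^ (2 * t) * real (energy \<gamma> A t) \<le> K * real (energy \<gamma> A (2 * t))"
  shows "\<exists>B\<subseteq>A. real (card A) \<le> K ^ 4 * real (card B) \<and>
    (\<forall>D m q. D \<subseteq> B \<longrightarrow> real (card A) \<le> K ^ q * real (card D) \<longrightarrow>
      real (card (nsum m ((\<pi> \<circ> \<gamma>) ` B) + uminus ` nsum m ((\<pi> \<circ> \<gamma>) ` B)))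
        \<le> K ^ (120 * (m + t) + 52 + 2 * t * q) * real (card (nsum t ((\<pi> \<circ> \<gamma>) ` D))))"
proof -
  define E where "E = real (energy \<gamma> A t)"
  define n where "n = real (card A) ^ t"
  let ?V = "tuples A t" and ?\<phi> = "list_value \<gamma>"
  have E0: "E > 0" using energy_pos[OF fin ne] by (simp add: E_def)
  have cA: "real (card A) > 0" using fin ne by (simp add: card_gt_0_iff)
  have n0: "n > 0" using cA by (simp add: n_def)
  have cV: "real (card ?V) = n" using fin by (simp add: card_tuples n_def)
  have n2: "n\<^sup>2 = real (card A) ^ (2 * t)" by (simp add: n_def power_mult mult.commute flip: power_mult)
  have "(real (card ?V))\<^sup>2 * E \<le> K * real (energy \<gamma> A (2 * t))"
    using large by (simp add: cV n2 E_def)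
  also have "\<dots> \<le> K * real (card {(p, q). p \<in> ?V \<times> ?V \<and> q \<in> ?V \<times> ?V \<and>
        ?\<phi> (fst p) - ?\<phi> (snd p) = ?\<phi> (fst q) - ?\<phi> (snd q)})"
    using energy_double[OF fin, of \<gamma> t] K by (intro mult_left_mono) auto
  finally have "\<exists>U\<subseteq>?V. real (card ?V) \<le> K ^ 4 * real (card U) \<and>
    real (card (?\<phi> ` U + uminus ` ?\<phi> ` U)) * E \<le> K ^ 52 * (real (card ?V))\<^sup>2"
    using fin K by (intro balog_szemeredi_gowers) (simp_all add: E_def energy_def)
  then obtain U where U: "U \<subseteq> ?V" "n \<le> K ^ 4 * real (card U)"
    and PP: "real (card (?\<phi> ` U + uminus ` ?\<phi> ` U)) * E \<le> K ^ 52 * n\<^sup>2"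
    unfolding cV by blast
  have finU: "finite U" using U fin finite_subset finite_tuples by blast
  have U0: "U \<noteq> {}" using U(2) n0 by auto
  define P where "P = ?\<phi> ` U"
  have finP: "finite P" and P0: "P \<noteq> {}" using finU U0 by (auto simp: P_def)
  have "(card U)\<^sup>2 \<le> card {(x, y). x \<in> U \<and> y \<in> U \<and> ?\<phi> x = ?\<phi> y} * card P"
    unfolding P_def by (rule card_sq_le_card_image[OF finU])
  also have "card {(x, y). x \<in> U \<and> y \<in> U \<and> ?\<phi> x = ?\<phi> y} \<le> energy \<gamma> A t"
    unfolding energy_def
  proof (rule card_mono)
    show "finite {(x, y). x \<in> ?V \<and> y \<in> ?V \<and> ?\<phi> x = ?\<phi> y}"
      by (rule finite_subset[of _ "?V \<times> ?V"]) (use fin in auto)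
  qed (use U in auto)
  finally have "real ((card U)\<^sup>2) \<le> real (energy \<gamma> A t * card P)" by (simp del: of_nat_mult of_nat_power)
  then have cU: "(real (card U))\<^sup>2 \<le> E * real (card P)" by (simp add: E_def)
  have "n\<^sup>2 \<le> (K ^ 4 * real (card U))\<^sup>2" using U(2) n0 by (intro power_mono) auto
  also have "\<dots> = K ^ 8 * (real (card U))\<^sup>2" by (simp add: power_mult_distrib flip: power_mult)
  also have "\<dots> \<le> K ^ 8 * (E * real (card P))" using cU K by (intro mult_left_mono) auto
  finally have n2P: "n\<^sup>2 \<le> K ^ 8 * (E * real (card P))" .
  have "real (card (P + uminus ` P)) * E \<le> K ^ 52 * (K ^ 8 * (E * real (card P)))"
    using PP n2P K by (smt (verit) P_def mult_left_mono zero_le_power)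
  also have "\<dots> = K ^ 60 * real (card P) * E" by (simp add: mult.assoc[symmetric] flip: power_add)
  finally have doubling: "real (card (P + uminus ` P)) \<le> K ^ 60 * real (card P)"
    by (rule mult_right_le_imp_le) (rule E0)
  \<comment> \<open>The doubling constant K^60 enters 2 m times. Replacing |P| by |P - P| lets
    \<open>PP\<close> express the bound as a multiple of n^2 / E.\<close>
  have growth: "real (card (nsum m P + uminus ` nsum m P)) * E \<le> K ^ (120 * m + 52) * n\<^sup>2" for m
  proof -
    have "real (card (nsum m P + uminus ` nsum m P)) \<le> (K ^ 60) ^ (2 * m) * real (card P)"
      by (rule nsum_difference_bound[OF finP P0 doubling])
    also have "\<dots> \<le> K ^ (120 * m) * real (card (P + uminus ` P))"
      using finP P0 K by (auto simp: mult.assoc[symmetric] simp flip: power_mult intro!: mult_left_mono card_le_plus)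
    finally have "real (card (nsum m P + uminus ` nsum m P)) * E \<le> K ^ (120 * m) * real (card (P + uminus ` P)) * E"
      using E0 by (intro mult_right_mono) auto
    also have "\<dots> = K ^ (120 * m) * (real (card (P + uminus ` P)) * E)" by simp
    also have "\<dots> \<le> K ^ (120 * m) * (K ^ 52 * n\<^sup>2)"
      using PP K by (intro mult_left_mono) (auto simp: P_def)
    finally show ?thesis by (simp add: power_add mult_ac)
  qed
  obtain r where r: "t = Suc r" using t by (cases t) auto
  obtain w where w: "real (card A) \<le> K ^ 4 * real (card {a\<in>A. a # w \<in> U})"
    using exists_dense_fibre[OF fin, of U r "K ^ 4"] U U0 by (auto simp: r n_def)
  define B where "B = {a\<in>A. a # w \<in> U}"
  have BA: "B \<subseteq> A" by (auto simp: B_def)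
  have finB: "finite B" using BA fin finite_subset by blast
  have B0: "B \<noteq> {}" using w[folded B_def] cA by auto
  define c where "c = ?\<phi> w"
  \<comment> \<open>Elements of \<open>B\<close> complete the fixed tail \<open>w\<close> to a tuple
    of \<open>U\<close>, so adding the value \<open>c\<close> of the tail leads into
    \<open>P\<close>.\<close>
  have BP: "\<gamma> ` B + {c} \<subseteq> P"
    by (force simp: B_def P_def c_def set_plus_def)
  have sub: "nsum m (\<gamma> ` B) + {d} \<subseteq> nsum m P" if "d = sum_list (replicate m c)" for m d
    using that
  proof (induction m arbitrary: d)
    case (Suc m)
    have "nsum (Suc m) (\<gamma> ` B) + {d} = (\<gamma> ` B + {c}) + (nsum m (\<gamma> ` B) + {sum_list (replicate m c)})"
    proof -
      have "{d} = {c} + {sum_list (replicate m c)}" using Suc by (simp add: set_plus_def)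
      then show ?thesis by (simp only: nsum.simps add_ac)
    qed
    also have "\<dots> \<subseteq> P + nsum m P" using BP Suc by (intro set_plus_mono2) auto
    finally show ?case by simp
  qed auto
  have growthB: "real (card (nsum m (\<gamma> ` B) + uminus ` nsum m (\<gamma> ` B))) * E \<le> K ^ (120 * m + 52) * n\<^sup>2" for m
  proof -
    let ?S = "nsum m (\<gamma> ` B)"
    let ?c = "sum_list (replicate m c)"
    have "?S + uminus ` ?S = (?S + {?c}) + uminus ` (?S + {?c})"
    proof -
      have "(?S + {?c}) + uminus ` (?S + {?c}) = (?S + uminus ` ?S) + ({?c} + {- ?c})"
        by (simp add: uminus_set_plus add_ac)
      also have "{?c} + {- ?c} = {0}" by (simp add: set_plus_def)
      also have "(?S + uminus ` ?S) + {0} = ?S + uminus ` ?S" by (simp add: add.commute)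
      finally show ?thesis by simp
    qed
    also have "\<dots> \<subseteq> nsum m P + uminus ` nsum m P"
      using sub[OF refl, of m] by (intro set_plus_mono2 image_mono)
    finally have "card (?S + uminus ` ?S) \<le> card (nsum m P + uminus ` nsum m P)"
      using finP by (intro card_mono finite_set_plus) auto
    then have "real (card (?S + uminus ` ?S)) * E \<le> real (card (nsum m P + uminus ` nsum m P)) * E"
      using E0 by (intro mult_right_mono) auto
    also note growth
    finally show ?thesis .
  qed
  have \<pi>0: "\<pi> 0 = 0" using hom[of 0 0] by simp
  have \<pi>neg: "\<pi> (- x) = - \<pi> x" for x using hom[of x "- x"] \<pi>0 by (simp add: eq_neg_iff_add_eq_0 add.commute)
  have \<pi>nsum: "\<pi> ` nsum m (\<gamma> ` D) = nsum m ((\<pi> \<circ> \<gamma>) ` D)" for m D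
    by (simp add: nsum_image[of \<pi>, OF \<pi>0 hom] image_comp)
  have main: "real (card (nsum m ((\<pi> \<circ> \<gamma>) ` B) + uminus ` nsum m ((\<pi> \<circ> \<gamma>) ` B)))
        \<le> K ^ (120 * (m + t) + 52 + 2 * t * q) * real (card (nsum t ((\<pi> \<circ> \<gamma>) ` D)))"
    if D: "D \<subseteq> B" "real (card A) \<le> K ^ q * real (card D)" for D m q
  proof -
    have finD: "finite D" using D finB finite_subset by blast
    have D0: "D \<noteq> {}" using D cA by auto
    define Y where "Y = nsum t (\<gamma> ` D)"
    define Z where "Z = nsum m (\<gamma> ` B) + uminus ` nsum m (\<gamma> ` B)"
    have finY: "finite Y" and Y0: "Y \<noteq> {}"
      using finD D0 nsum_nonempty[of "\<gamma> ` D"] by (auto simp: Y_def)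
    have finZ: "finite Z" using finB by (simp add: Z_def finite_set_plus)
    have "\<pi> ` Z = \<pi> ` nsum m (\<gamma> ` B) + uminus ` \<pi> ` nsum m (\<gamma> ` B)"
      unfolding Z_def image_set_plus[of \<pi>, OF hom] image_image \<pi>neg ..
    then have \<pi>Z: "\<pi> ` Z = nsum m ((\<pi> \<circ> \<gamma>) ` B) + uminus ` nsum m ((\<pi> \<circ> \<gamma>) ` B)"
      by (simp add: \<pi>nsum)
    let ?S = "nsum (m + t) (\<gamma> ` B)"
    \<comment> \<open>Subtracting t-fold sums of \<gamma> B does not shrink \<open>Z + Y\<close>,
      and enlarging \<open>Y\<close> to all t-fold sums of \<gamma> B then gives a difference set of
      order m + t, which \<open>growthB\<close> bounds.\<close>
    have "card (Z + Y) \<le> card (Z + Y + uminus ` nsum t (\<gamma> ` B))"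
      using finZ finY finB B0 nsum_nonempty[of "\<gamma> ` B" t] by (intro card_le_plus finite_set_plus) auto
    also have "\<dots> \<le> card (Z + nsum t (\<gamma> ` B) + uminus ` nsum t (\<gamma> ` B))"
      unfolding Y_def using finZ finB D
      by (intro card_mono finite_set_plus set_plus_mono2 nsum_mono image_mono) auto
    also have "Z + nsum t (\<gamma> ` B) + uminus ` nsum t (\<gamma> ` B) = ?S + uminus ` ?S"
      by (simp add: Z_def nsum_add uminus_set_plus add_ac)
    finally have "real (card (Z + Y)) * E \<le> real (card (?S + uminus ` ?S)) * E"
      using E0 by (intro mult_right_mono) auto
    also note growthB
    finally have ZY: "real (card (Z + Y)) * E \<le> K ^ (120 * (m + t) + 52) * n\<^sup>2" .
    have "card D ^ (2 * t) \<le> energy \<gamma> D t * card Y"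
      unfolding Y_def by (rule card_power_le_energy_nsum[OF finD])
    also have "\<dots> \<le> energy \<gamma> A t * card Y"
      using energy_mono[OF fin, of D] D BA by (intro mult_right_mono) auto
    finally have "real (card D ^ (2 * t)) \<le> real (energy \<gamma> A t * card Y)"
      by (simp del: of_nat_mult of_nat_power)
    then have DY: "real (card D) ^ (2 * t) \<le> E * real (card Y)" by (simp add: E_def)
    have "n\<^sup>2 \<le> (K ^ q * real (card D)) ^ (2 * t)"
      unfolding n2 using D by (intro power_mono) auto
    also have "\<dots> = K ^ (2 * t * q) * real (card D) ^ (2 * t)"
      by (simp add: power_mult_distrib mult.commute flip: power_mult)
    also have "\<dots> \<le> K ^ (2 * t * q) * (E * real (card Y))"
      using DY K by (intro mult_left_mono) auto
    finally have nY: "n\<^sup>2 \<le> K ^ (2 * t * q) * (E * real (card Y))" .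
    \<comment> \<open>The ratio |Z + Y| / |Y| passes to the images under \<open>\<pi>\<close>; in
      the estimates \<open>ZY\<close> and \<open>nY\<close> the common quantity n^2 / E
      cancels.\<close>
    have "card (\<pi> ` Z) * card Y \<le> card (Z + Y) * card (\<pi> ` Y)"
      by (rule card_image_hom_le) (use hom finZ finY Y0 in auto)
    then have "real (card (\<pi> ` Z)) * real (card Y) \<le> real (card (Z + Y)) * real (card (\<pi> ` Y))"
      by (simp flip: of_nat_mult)
    then have "real (card (\<pi> ` Z)) * real (card Y) * E \<le> real (card (Z + Y)) * real (card (\<pi> ` Y)) * E"
      using E0 by (intro mult_right_mono) auto
    also have "\<dots> = real (card (Z + Y)) * E * real (card (\<pi> ` Y))" by simp
    also have "\<dots> \<le> K ^ (120 * (m + t) + 52) * n\<^sup>2 * real (card (\<pi> ` Y))"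
      using ZY by (intro mult_right_mono) auto
    also have "\<dots> \<le> K ^ (120 * (m + t) + 52) * (K ^ (2 * t * q) * (E * real (card Y))) * real (card (\<pi> ` Y))"
      using nY K by (intro mult_right_mono mult_left_mono) auto
    also have "\<dots> = K ^ (120 * (m + t) + 52 + 2 * t * q) * real (card (\<pi> ` Y)) * (real (card Y) * E)"
      by (simp add: power_add mult_ac)
    finally have "real (card (\<pi> ` Z)) * (real (card Y) * E)
        \<le> K ^ (120 * (m + t) + 52 + 2 * t * q) * real (card (\<pi> ` Y)) * (real (card Y) * E)"
      by (simp only: mult.assoc)
    moreover have "real (card Y) * E > 0" using finY Y0 E0 by (simp add: card_gt_0_iff)
    ultimately have "real (card (\<pi> ` Z)) \<le> K ^ (120 * (m + t) + 52 + 2 * t * q) * real (card (\<pi> ` Y))"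
      using mult_right_le_imp_le by blast
    then show ?thesis by (simp only: \<pi>Z Y_def \<pi>nsum)
  qed
  show ?thesis using BA w main by (intro exI[of _ B]) (auto simp: B_def[symmetric])
qed

section \<open>Sets of integers with a small product set\<close>

lemma set_plus_nonempty: "S \<noteq> {} \<Longrightarrow> T \<noteq> {} \<Longrightarrow> S + T \<noteq> {}"
  by (auto simp: set_plus_def)

text \<open>Cauchy--Schwarz gives at least |B|^4 / |B * B| solutions of a c = b d, and some
  \<open>b\<close> has at least an average share. As 0 is excluded, a, b, c determine d, and the
  summand at \<open>a\<close> is the size of the intersection of a B and b B.\<close>

lemma popular_dilate:
  fixes B :: "'a::idom set" and \<kappa> :: real
  assumes fin: "finite B" and ne: "B \<noteq> {}" and zero: "0 \<notin> B"
    and small: "real (card (B * B)) \<le> \<kappa> * real (card B)"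
  shows "\<exists>b\<in>B. (real (card B))\<^sup>2 \<le> \<kappa> * (\<Sum>a\<in>B. real (card {c\<in>B. \<exists>d\<in>B. a * c = b * d}))"
proof -
  define n where "n = real (card B)"
  have n0: "n > 0" using fin ne by (simp add: n_def card_gt_0_iff)
  define D where "D a b = {c\<in>B. \<exists>d\<in>B. a * c = b * d}" for a b
  have finD: "finite (D a b)" for a b using fin by (simp add: D_def)
  let ?Q = "{(p, q). p \<in> B \<times> B \<and> q \<in> B \<times> B \<and> fst p * snd p = fst q * snd q}"
  have "(\<lambda>p. fst p * snd p) ` (B \<times> B) = B * B" by (force simp: set_times_def)
  then have "(card (B \<times> B))\<^sup>2 \<le> card ?Q * card (B * B)"
    using card_sq_le_card_image[of "B \<times> B" "\<lambda>p. fst p * snd p"] fin by simp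
  also have "card ?Q \<le> card (SIGMA b:B. SIGMA a:B. D a b)"
  proof (rule card_inj_on_le)
    let ?f = "\<lambda>((a, c), (b, d)). (b, (a, c))"
    show "inj_on ?f ?Q" using zero by (auto simp: inj_on_def)
    show "?f ` ?Q \<subseteq> (SIGMA b:B. SIGMA a:B. D a b)" by (auto simp: D_def)
  qed (use fin finD in auto)
  also have "\<dots> = (\<Sum>b\<in>B. \<Sum>a\<in>B. card (D a b))" using fin finD by simp
  finally have "real ((card (B \<times> B))\<^sup>2) \<le> real ((\<Sum>b\<in>B. \<Sum>a\<in>B. card (D a b)) * card (B * B))"
    unfolding of_nat_le_iff by simp
  then have "n ^ 4 \<le> (\<Sum>b\<in>B. \<Sum>a\<in>B. real (card (D a b))) * real (card (B * B))"
    by (simp add: n_def card_cartesian_product power_mult_distrib flip: power_add)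
  also have "\<dots> \<le> (\<Sum>b\<in>B. \<Sum>a\<in>B. real (card (D a b))) * (\<kappa> * n)"
    using small by (intro mult_left_mono) (auto simp: n_def intro!: sum_nonneg)
  finally have "n\<^sup>2 * n * n \<le> (\<kappa> * (\<Sum>b\<in>B. \<Sum>a\<in>B. real (card (D a b)))) * n"
    by (simp add: power_numeral_reduce mult_ac)
  then have "n\<^sup>2 * n \<le> \<kappa> * (\<Sum>b\<in>B. \<Sum>a\<in>B. real (card (D a b)))"
    by (rule mult_right_le_imp_le) (rule n0)
  then have "n\<^sup>2 * real (card B) \<le> (\<Sum>b\<in>B. \<kappa> * (\<Sum>a\<in>B. real (card (D a b))))"
    by (simp add: n_def sum_distrib_left)
  then show ?thesis using exists_sum_le[OF ne fin] unfolding n_def D_def by blast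
qed

section \<open>Covering by translates of a difference set\<close>

definition difference_set :: "nat \<Rightarrow> 'a::ab_group_add set \<Rightarrow> 'a set" where
  "difference_set m X = nsum m X + uminus ` nsum m X"

lemma difference_set_add:
  assumes "x \<in> difference_set m X" "y \<in> difference_set n X"
  shows "x + y \<in> difference_set (m + n) X"
proof -
  have "difference_set (m + n) X = difference_set m X + difference_set n X"
    by (simp add: difference_set_def nsum_add uminus_set_plus add_ac)
  then show ?thesis using assms by auto
qed

lemma difference_set_neg:
  assumes "x \<in> difference_set m X"
  shows "- x \<in> difference_set m X"
proof -
  obtain u v where "u \<in> nsum m X" "v \<in> nsum m X" "x = u + - v"
    using assms by (auto simp: difference_set_def set_plus_def)
  then have "- x = v + - u" by simp
  moreover have "v + - u \<in> difference_set m X"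
    unfolding difference_set_def using \<open>u \<in> _\<close> \<open>v \<in> _\<close> by (intro set_plus_intro) auto
  ultimately show ?thesis by (simp only:)
qed

text \<open>The multipliers that map \<open>X\<close> into few translates of a difference set of \<open>b X\<close> are stable under
  boundedly many additions and subtractions, so \<open>X\<close> behaves like an approximate ideal.\<close>

definition covers :: "int set \<Rightarrow> int \<Rightarrow> nat \<Rightarrow> real \<Rightarrow> int \<Rightarrow> bool" where
  "covers X b m \<kappa> z \<longleftrightarrow> (\<exists>Y. finite Y \<and> real (card Y) \<le> \<kappa> \<and>
     (\<forall>x\<in>X. \<exists>y\<in>Y. \<exists>e\<in>difference_set m X. z * x = y + b * e))"

lemma covers_neg: "covers X b m \<kappa> z \<Longrightarrow> covers X b m \<kappa> (- z)"
proof -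
  assume "covers X b m \<kappa> z"
  then obtain Y where Y: "finite Y" "real (card Y) \<le> \<kappa>"
    "\<And>x. x \<in> X \<Longrightarrow> \<exists>y\<in>Y. \<exists>e\<in>difference_set m X. z * x = y + b * e"
    unfolding covers_def by blast
  have "\<exists>y\<in>uminus ` Y. \<exists>e\<in>difference_set m X. - z * x = y + b * e" if x: "x \<in> X" for x
  proof -
    obtain y e where "y \<in> Y" "e \<in> difference_set m X" "z * x = y + b * e" using Y(3)[OF x] by blast
    then have "- z * x = - y + b * (- e)" "- y \<in> uminus ` Y" by auto
    then show ?thesis using difference_set_neg \<open>e \<in> _\<close> by blast
  qed
  then show "covers X b m \<kappa> (- z)"
    unfolding covers_def using Y by (intro exI[of _ "uminus ` Y"]) auto
qed

lemma covers_add: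
  assumes "covers X b m \<kappa> z" "covers X b n \<mu> w"
  shows "covers X b (m + n) (\<kappa> * \<mu>) (z + w)"
proof -
  obtain Y where Y: "finite Y" "real (card Y) \<le> \<kappa>"
    "\<And>x. x \<in> X \<Longrightarrow> \<exists>y\<in>Y. \<exists>e\<in>difference_set m X. z * x = y + b * e"
    using assms(1) unfolding covers_def by blast
  obtain W where W: "finite W" "real (card W) \<le> \<mu>"
    "\<And>x. x \<in> X \<Longrightarrow> \<exists>y\<in>W. \<exists>e\<in>difference_set n X. w * x = y + b * e"
    using assms(2) unfolding covers_def by blast
  have "real (card (Y + W)) \<le> real (card Y) * real (card W)"
    using card_plus_le[OF Y(1) W(1)] by (simp flip: of_nat_mult)
  also have "\<dots> \<le> \<kappa> * \<mu>"
    using Y(2) W(2) by (intro mult_mono) linarith+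
  finally have "real (card (Y + W)) \<le> \<kappa> * \<mu>" .
  moreover have "\<exists>y\<in>Y + W. \<exists>e\<in>difference_set (m + n) X. (z + w) * x = y + b * e" if x: "x \<in> X" for x
  proof -
    obtain y e where y: "y \<in> Y" "e \<in> difference_set m X" "z * x = y + b * e" using Y(3)[OF x] by blast
    obtain y' e' where y': "y' \<in> W" "e' \<in> difference_set n X" "w * x = y' + b * e'" using W(3)[OF x] by blast
    have "(z + w) * x = (y + y') + b * (e + e')" using y y' by (simp add: algebra_simps)
    moreover have "y + y' \<in> Y + W" using y y' by (intro set_plus_intro)
    ultimately show ?thesis using difference_set_add[OF y(2) y'(2)] by blast
  qed
  ultimately show ?thesis
    unfolding covers_def using finite_set_plus[OF Y(1) W(1)] by (intro exI[of _ "Y + W"]) simp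
qed

lemma covers_nsum:
  assumes "\<And>z. z \<in> C \<Longrightarrow> covers X b 1 \<kappa> z" "z \<in> nsum j C"
  shows "covers X b j (\<kappa> ^ j) z"
  using assms(2)
proof (induction j arbitrary: z)
  case 0
  then show ?case
    unfolding covers_def by (intro exI[of _ "{0}"]) (simp add: difference_set_def)
next
  case (Suc j)
  then obtain c w where "c \<in> C" "w \<in> nsum j C" "z = c + w" by (auto simp: set_plus_def)
  then show ?case using covers_add[OF assms(1)[of c] Suc.IH[of w]] by simp
qed

text \<open>The pivot argument: adding 1 to the largest quotient of differences of \<open>W\<close> gives a number \<open>\<xi> = (u + v) / v\<close>
  that is not such a quotient, and then \<open>(x, y) \<mapsto> x + \<xi> y\<close> is injective on \<open>W \<times> W\<close>.\<close>

lemma exists_pivot: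
  fixes W :: "int set"
  assumes fin: "finite W" and two: "card W > 1"
  shows "\<exists>p\<in>W. \<exists>q\<in>W. \<exists>r\<in>W. \<exists>s\<in>W.
    inj_on (\<lambda>(x, y). (r - s) * x + ((p - q) + (r - s)) * y) (W \<times> W)"
proof -
  define R where "R = {(u, v). u \<in> (\<lambda>(p, q). p - q) ` (W \<times> W) \<and> v \<in> (\<lambda>(p, q). p - q) ` (W \<times> W) \<and> v \<noteq> 0}"
  have "finite R"
    by (rule finite_subset[of _ "(\<lambda>(p, q). p - q) ` (W \<times> W) \<times> (\<lambda>(p, q). p - q) ` (W \<times> W)"])
      (use fin in \<open>auto simp: R_def\<close>)
  moreover obtain x y where "x \<in> W" "y \<in> W" "x \<noteq> y"
    using two by (metis card_le_Suc0_iff_eq fin One_nat_def linorder_not_less)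
  then have "(x - y, x - y) \<in> R" by (auto simp: R_def)
  then have "R \<noteq> {}" by blast
  ultimately obtain g where "is_arg_min (\<lambda>h. - (real_of_int (fst h) / real_of_int (snd h))) (\<lambda>h. h \<in> R) g"
    using ex_is_arg_min_if_finite by blast
  then have g: "g \<in> R" and
    max: "\<And>h. h \<in> R \<Longrightarrow> real_of_int (fst h) / real_of_int (snd h) \<le> real_of_int (fst g) / real_of_int (snd g)"
    by (simp_all add: is_arg_min_linorder)
  obtain u v where uv: "g = (u, v)" by fastforce
  obtain p q r s where pqrs: "p \<in> W" "q \<in> W" "r \<in> W" "s \<in> W" "u = p - q" "v = r - s" "v \<noteq> 0"
    using g by (auto simp: R_def uv)
  have "inj_on (\<lambda>(x, y). v * x + (u + v) * y) (W \<times> W)"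
  proof (rule inj_onI, clarify)
    fix x y x' y' assume a: "x \<in> W" "y \<in> W" "x' \<in> W" "y' \<in> W" "v * x + (u + v) * y = v * x' + (u + v) * y'"
    have e: "v * (x - x') = (u + v) * (y' - y)" using a(5) by (simp add: algebra_simps)
    have "y' = y"
    proof (rule ccontr)
      assume ne: "y' \<noteq> y"
      then have "(x - x', y' - y) \<in> R" using a by (auto simp: R_def)
      then have "real_of_int (x - x') / real_of_int (y' - y) \<le> real_of_int u / real_of_int v"
        using max uv by fastforce
      moreover have "real_of_int (x - x') / real_of_int (y' - y) = real_of_int (u + v) / real_of_int v"
        using ne pqrs(7) arg_cong[OF e, of real_of_int] by (simp add: frac_eq_eq mult.commute del: of_int_add of_int_diff)
      ultimately show False using pqrs(7) by (simp add: add_divide_distrib)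
    qed
    then show "x = x' \<and> y = y'" using e pqrs(7) by simp
  qed
  then show ?thesis using pqrs by blast
qed

text \<open>The growth hypothesis lets Ruzsa covering show that each popular multiplier a maps X = t
  B into few translates of b (X - X). This extends to sums W = t C of popular multipliers, and the
  pivot then forces |W|^2 \<le> K^(6 t Q + Q) |W|. The order \<open>6 * t * t\<close> arises because
  the pivot uses six elements of W, each a sum of t multipliers, acting on t-fold sums.\<close>

lemma small_product_set_bound:
  fixes B :: "int set" and K :: real
  assumes fin: "finite B" and ne: "B \<noteq> {}" and zero: "0 \<notin> B" and K: "K \<ge> 2" and t: "t \<ge> 1"
    and small: "real (card (B * B)) \<le> K ^ 6 * real (card B)"
    and growth: "\<And>D. D \<subseteq> B \<Longrightarrow> real (card B) \<le> K ^ 7 * real (card D) \<Longrightarrow>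
      real (card (difference_set (6 * t * t) B)) \<le> K ^ Q * real (card (nsum t D))"
  shows "real (card B) \<le> K ^ (7 + 6 * t * Q + Q)"
proof -
  define n where "n = real (card B)"
  have n0: "n > 0" using fin ne by (simp add: n_def card_gt_0_iff)
  obtain b where b: "b \<in> B" and
    pop: "n\<^sup>2 \<le> K ^ 6 * (\<Sum>a\<in>B. real (card {c\<in>B. \<exists>d\<in>B. a * c = b * d}))"
    using popular_dilate[OF fin ne zero small] unfolding n_def by blast
  define D where "D a = {c\<in>B. \<exists>d\<in>B. a * c = b * d}" for a
  have finD: "finite (D a)" and DB: "D a \<subseteq> B" for a using fin by (auto simp: D_def)
  \<comment> \<open>The threshold is one factor \<open>K\<close> below the average density K^(-6).
    Multipliers outside \<open>C\<close> then account for at most n / K \<le> n / 2, so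
    \<open>C\<close> itself must be dense.\<close>
  define C where "C = {a\<in>B. n \<le> K ^ 7 * real (card (D a))}"
  have CB: "C \<subseteq> B" and finC: "finite C" using fin by (auto simp: C_def)
  have K7: "K ^ 7 > 0" using K by simp
  have "(\<Sum>a\<in>B. real (card (D a))) = (\<Sum>a\<in>B - C. real (card (D a))) + (\<Sum>a\<in>C. real (card (D a)))"
    by (rule sum.subset_diff[OF CB fin])
  also have "(\<Sum>a\<in>B - C. real (card (D a))) \<le> (\<Sum>a\<in>B - C. n / K ^ 7)"
    by (rule sum_mono) (use K7 in \<open>auto simp: C_def field_simps\<close>)
  also have "\<dots> \<le> (\<Sum>a\<in>B. n / K ^ 7)" by (rule sum_mono2) (use fin n0 K7 in auto)
  also have "\<dots> = n * (n / K ^ 7)" by (simp add: n_def)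
  also have "(\<Sum>a\<in>C. real (card (D a))) \<le> (\<Sum>a\<in>C. n)"
    by (rule sum_mono) (use card_mono[OF fin DB] in \<open>auto simp: n_def\<close>)
  also have "\<dots> = real (card C) * n" by simp
  finally have "(\<Sum>a\<in>B. real (card (D a))) \<le> n * (n / K ^ 7) + real (card C) * n" by simp
  then have "K ^ 6 * (\<Sum>a\<in>B. real (card (D a))) \<le> K ^ 6 * (n * (n / K ^ 7) + real (card C) * n)"
    using K by (intro mult_left_mono) auto
  then have "n\<^sup>2 \<le> K ^ 6 * (n * (n / K ^ 7) + real (card C) * n)"
    using pop by (simp add: D_def)
  also have "\<dots> = (n / K + K ^ 6 * real (card C)) * n"
  proof -
    have "K ^ 6 / K ^ 7 = 1 / K" using K by (simp add: power_numeral_reduce)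
    moreover have "K ^ 6 * (n * (n / K ^ 7) + real (card C) * n) = (n * (K ^ 6 / K ^ 7) + K ^ 6 * real (card C)) * n"
      by (simp add: algebra_simps)
    ultimately show ?thesis by simp
  qed
  finally have "n * n \<le> (n / K + K ^ 6 * real (card C)) * n" by (simp add: power2_eq_square)
  then have "n \<le> n / K + K ^ 6 * real (card C)" by (rule mult_right_le_imp_le) (rule n0)
  moreover have "n / K \<le> n / 2" using K n0 by (intro divide_left_mono) auto
  ultimately have "n \<le> 2 * K ^ 6 * real (card C)" by linarith
  also have "\<dots> \<le> K * K ^ 6 * real (card C)" using K by (intro mult_right_mono) auto
  also have "K * K ^ 6 = K ^ 7" by (simp add: power_numeral_reduce)
  finally have nC: "n \<le> K ^ 7 * real (card C)" .
  define X where "X = nsum t B"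
  define W where "W = nsum t C"
  have finX: "finite X" and finW: "finite W" using fin finC by (auto simp: X_def W_def)
  have C0: "C \<noteq> {}" using nC n0 by auto
  have cCW: "card C \<le> card W" unfolding W_def by (rule card_le_nsum[OF finC t])
  have diffX: "difference_set (6 * t) X = difference_set (6 * t * t) B"
    by (simp add: difference_set_def X_def nsum_nsum)
  \<comment> \<open>Since a times \<open>D a\<close> lies in b B, multiplication by \<open>a\<close>
    maps the t-fold sumset T of \<open>D a\<close> into b X. A cover of \<open>X\<close> by
    translates of T - T therefore becomes a cover of a X by translates of b (X - X).\<close>
  have cov1: "covers X b 1 (K ^ Q) a" if a: "a \<in> C" for a
  proof -
    let ?T = "nsum t (D a)"
    have Da: "real (card B) \<le> K ^ 7 * real (card (D a))" using a by (simp add: C_def n_def)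
    have D0: "D a \<noteq> {}" using Da n0 by (auto simp: n_def)
    have T0: "?T \<noteq> {}" by (rule nsum_nonempty[OF D0])
    have finT: "finite ?T" using finD by simp
    \<comment> \<open>\<open>X + ?T\<close> consists of sums of 2 t elements of \<open>B\<close>;
      padding up to order 6 t^2 brings it within reach of \<open>growth\<close>.\<close>
    have "t + t \<le> 6 * t * t" using t by (cases t) auto
    then obtain r where r: "6 * t * t = t + t + r" using le_Suc_ex by blast
    have e: "nsum (6 * t * t) B = nsum (t + t) B + nsum r B"
      unfolding r by (rule nsum_add)
    have finB: "finite (nsum j B)" "nsum j B \<noteq> {}" for j using fin nsum_nonempty[OF ne] by auto
    have "card (X + ?T) \<le> card (nsum (t + t) B)"
      unfolding nsum_add X_def using fin DB by (intro card_mono finite_set_plus set_plus_mono2 nsum_mono) auto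
    also have "\<dots> \<le> card (nsum (t + t) B + (nsum r B + uminus ` nsum (6 * t * t) B))"
      using finB by (intro card_le_plus finite_set_plus set_plus_nonempty) auto
    also have "nsum (t + t) B + (nsum r B + uminus ` nsum (6 * t * t) B) = difference_set (6 * t * t) B"
      by (simp only: difference_set_def add.assoc[symmetric] e[symmetric])
    finally have "real (card (X + ?T)) \<le> real (card (difference_set (6 * t * t) B))" by simp
    also note growth[OF DB Da]
    finally obtain Y where Y: "Y \<subseteq> X" "real (card Y) \<le> K ^ Q" "X \<subseteq> Y + (?T + uminus ` ?T)"
      using ruzsa_covering[OF finX finT T0] by blast
    have finY: "finite Y" using Y finX finite_subset by blast
    have img: "(*) c ` nsum t S = nsum t ((*) c ` S)" for c :: int and S
      by (rule nsum_image) (auto simp: algebra_simps)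
    have "(*) a ` D a \<subseteq> (*) b ` B" by (auto simp: D_def)
    then have T: "(*) a ` ?T \<subseteq> (*) b ` X" unfolding img X_def by (rule nsum_mono)
    have "\<exists>y\<in>(*) a ` Y. \<exists>e\<in>difference_set 1 X. a * x = y + b * e" if "x \<in> X" for x
    proof -
      have "x \<in> Y + (?T + uminus ` ?T)" using Y that by blast
      then obtain y u v where yuv: "y \<in> Y" "u \<in> ?T" "v \<in> ?T" "x = y + (u + - v)"
        by (auto simp: set_plus_def)
      obtain u' v' where u': "u' \<in> X" "a * u = b * u'" and v': "v' \<in> X" "a * v = b * v'"
        using T yuv by blast
      have "a * x = a * y + (a * u - a * v)" unfolding yuv(4) by (simp add: algebra_simps)
      then have "a * x = a * y + b * (u' + - v')" unfolding u'(2) v'(2) by (simp add: algebra_simps)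
      moreover have "u' + - v' \<in> difference_set 1 X"
        using u' v' unfolding difference_set_def by (intro set_plus_intro) (auto simp: set_plus_def)
      ultimately show ?thesis using yuv by blast
    qed
    moreover have "real (card ((*) a ` Y)) \<le> K ^ Q"
      using Y(2) card_image_le[OF finY, of "(*) a"] by linarith
    ultimately show ?thesis unfolding covers_def using finY by blast
  qed
  have WX: "W \<subseteq> X" unfolding W_def X_def by (rule nsum_mono[OF CB])
  have cW: "real (card W) \<le> K ^ (6 * t * Q + Q)"
  proof (cases "card W > 1")
    case False
    then have "real (card W) \<le> 1" by simp
    also have "\<dots> \<le> K ^ (6 * t * Q + Q)" using K by simp
    finally show ?thesis .
  next
    case True
    obtain p q r s where pqrs: "p \<in> W" "q \<in> W" "r \<in> W" "s \<in> W"
      and inj: "inj_on (\<lambda>(x, y). (r - s) * x + ((p - q) + (r - s)) * y) (W \<times> W)"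
      using exists_pivot[OF finW True] by blast
    let ?\<kappa> = "(K ^ Q) ^ t"
    have cov: "covers X b t ?\<kappa> z" if "z \<in> W" for z
      using covers_nsum[of C X b "K ^ Q" z t] cov1 that by (simp add: W_def)
    have cov_diff: "covers X b (t + t) (?\<kappa> * ?\<kappa>) (z - w)" if "z \<in> W" "w \<in> W" for z w
      using covers_add[OF cov[OF that(1)] covers_neg[OF cov[OF that(2)]]] by simp
    define v where "v = r - s"
    define u where "u = (p - q) + (r - s)"
    obtain Y1 where Y1: "finite Y1" "real (card Y1) \<le> ?\<kappa> * ?\<kappa>"
      "\<And>x. x \<in> X \<Longrightarrow> \<exists>y\<in>Y1. \<exists>e\<in>difference_set (t + t) X. v * x = y + b * e"
      using cov_diff[OF pqrs(3,4)] unfolding covers_def v_def by blast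
    obtain Y2 where Y2: "finite Y2" "real (card Y2) \<le> (?\<kappa> * ?\<kappa>) * (?\<kappa> * ?\<kappa>)"
      "\<And>x. x \<in> X \<Longrightarrow> \<exists>y\<in>Y2. \<exists>e\<in>difference_set ((t + t) + (t + t)) X. u * x = y + b * e"
      using covers_add[OF cov_diff[OF pqrs(1,2)] cov_diff[OF pqrs(3,4)]] unfolding covers_def u_def by blast
    let ?E = "difference_set (6 * t) X"
    have finE: "finite ?E" using finX by (auto simp: difference_set_def intro!: finite_set_plus)
    have six: "(t + t) + ((t + t) + (t + t)) = 6 * t" by simp
    \<comment> \<open>The |W|^2 distinct values v x + u y fall into few translates of b E: the
      multiplier v uses order 2 t and u order 4 t, hence 6 t together.\<close>
    have "(\<lambda>(x, y). v * x + u * y) ` (W \<times> W) \<subseteq> (Y1 + Y2) + (*) b ` ?E"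
    proof clarify
      fix x y assume xy: "x \<in> W" "y \<in> W"
      obtain y1 e1 where 1: "y1 \<in> Y1" "e1 \<in> difference_set (t + t) X" "v * x = y1 + b * e1"
        using Y1(3) xy WX by blast
      obtain y2 e2 where 2: "y2 \<in> Y2" "e2 \<in> difference_set ((t + t) + (t + t)) X" "u * y = y2 + b * e2"
        using Y2(3) xy WX by blast
      have "v * x + u * y = (y1 + y2) + b * (e1 + e2)" using 1 2 by (simp add: algebra_simps)
      moreover have "e1 + e2 \<in> ?E" using difference_set_add[OF 1(2) 2(2)] by (simp only: six)
      then have "(y1 + y2) + b * (e1 + e2) \<in> (Y1 + Y2) + (*) b ` ?E"
        using 1(1) 2(1) by (intro set_plus_intro imageI)
      ultimately show "v * x + u * y \<in> (Y1 + Y2) + (*) b ` ?E" by (simp only:)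
    qed
    then have "card ((\<lambda>(x, y). v * x + u * y) ` (W \<times> W)) \<le> card ((Y1 + Y2) + (*) b ` ?E)"
      using Y1 Y2 finE by (intro card_mono finite_set_plus finite_imageI)
    moreover have "card ((\<lambda>(x, y). v * x + u * y) ` (W \<times> W)) = card W * card W"
      using card_image[OF inj] by (simp add: v_def u_def card_cartesian_product)
    moreover have "card ((Y1 + Y2) + (*) b ` ?E) \<le> card Y1 * card Y2 * card ?E"
    proof -
      have "card ((Y1 + Y2) + (*) b ` ?E) \<le> card (Y1 + Y2) * card ((*) b ` ?E)"
        using Y1 Y2 finE by (intro card_plus_le finite_set_plus finite_imageI)
      also have "\<dots> \<le> (card Y1 * card Y2) * card ?E"
        using Y1 Y2 finE by (intro mult_mono card_plus_le card_image_le) auto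
      finally show ?thesis .
    qed
    ultimately have "card W * card W \<le> card Y1 * card Y2 * card ?E" by simp
    then have "real (card W) * real (card W) \<le> real (card Y1) * real (card Y2) * real (card ?E)"
      by (simp flip: of_nat_mult)
    \<comment> \<open>Applying \<open>growth\<close> to the dense set \<open>C\<close> bounds |E| by
      K^Q |W|, so one factor |W| cancels. The six factors \<open>?\<kappa>\<close> give K^(6 t
      Q).\<close>
    also have "\<dots> \<le> (?\<kappa> * ?\<kappa>) * ((?\<kappa> * ?\<kappa>) * (?\<kappa> * ?\<kappa>)) * (K ^ Q * real (card W))"
      using Y1(2) Y2(2) growth[OF CB] nC K unfolding diffX
      by (intro mult_mono) (auto simp: W_def n_def)
    also have "\<dots> = K ^ (6 * t * Q + Q) * real (card W)"
    proof -
      have "(?\<kappa> * ?\<kappa>) * ((?\<kappa> * ?\<kappa>) * (?\<kappa> * ?\<kappa>)) = K ^ (6 * t * Q)"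
        by (simp only: power_mult[symmetric] power_add[symmetric]) (rule arg_cong[of _ _ "\<lambda>j. K ^ j"], simp)
      then show ?thesis by (simp add: power_add)
    qed
    finally show ?thesis
      by (rule mult_right_le_imp_le) (use True in simp)
  qed
  have "n \<le> K ^ 7 * real (card C)" by (rule nC)
  also have "\<dots> \<le> K ^ 7 * K ^ (6 * t * Q + Q)"
    using cCW cW K by (intro mult_left_mono) (auto intro: order_trans)
  finally show ?thesis by (simp add: n_def add.assoc flip: power_add)
qed

section \<open>The mean value J\<close>

text \<open>Padding by zero outside \<open>{1..k}\<close> makes equality of sums, as functions, the
  same as the k equations of the system; pointwise addition supplies the group structure that
  energies require.\<close>

definition moment_point :: "nat \<Rightarrow> int \<Rightarrow> nat \<Rightarrow> int" where
  "moment_point k a = (\<lambda>j. if j \<in> {1..k} then a ^ j else 0)"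

lemma list_value_moment_point:
  "list_value (moment_point k) xs j = (if j \<in> {1..k} then (\<Sum>x\<leftarrow>xs. x ^ j) else 0)"
  by (induction xs) (auto simp: list_value_def moment_point_def)

lemma bij_betw_vimage_restrict:
  assumes "bij_betw f A B"
  shows "bij_betw f {a\<in>A. f a \<in> X} {b\<in>B. b \<in> X}"
  using assms by (auto simp: bij_betw_def inj_on_def)

lemma J_eq_energy:
  assumes "finite A"
  shows "J s k A = energy (moment_point k) A s"
proof -
  \<comment> \<open>Functions are indexed from 1 and lists from 0, hence the shifts
    \<open>Suc i\<close> and \<open>i - 1\<close>.\<close>
  define F where "F x = map (\<lambda>i. x (Suc i)) [0..<s]" for x :: "nat \<Rightarrow> int"
  define G where "G xs = (\<lambda>i\<in>{1..s}. xs ! (i - 1))" for xs :: "int list"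
  have bij: "bij_betw F ({1..s} \<rightarrow>\<^sub>E A) (tuples A s)"
  proof (rule bij_betwI[where g = G])
    show "F \<in> ({1..s} \<rightarrow>\<^sub>E A) \<rightarrow> tuples A s"
      by (auto simp: F_def tuples_def PiE_def Pi_def)
    show "G \<in> tuples A s \<rightarrow> ({1..s} \<rightarrow>\<^sub>E A)"
    proof
      fix xs assume xs: "xs \<in> tuples A s"
      have "xs ! (i - 1) \<in> A" if "i \<in> {1..s}" for i
      proof -
        have "xs ! (i - 1) \<in> set xs" using xs that by (intro nth_mem) (auto simp: tuples_def)
        then show ?thesis using xs by (auto simp: tuples_def)
      qed
      then show "G xs \<in> {1..s} \<rightarrow>\<^sub>E A" by (simp add: G_def)
    qed
  next
    fix x assume x: "x \<in> {1..s} \<rightarrow>\<^sub>E A"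
    show "G (F x) = x"
    proof
      fix i
      \<comment> \<open>Outside \<open>{1..s}\<close> both functions take the default value
        \<open>undefined\<close>.\<close>
      show "G (F x) i = x i"
        using PiE_arb[OF x, of i] by (cases "i \<in> {1..s}") (auto simp: F_def G_def)
    qed
  next
    fix xs assume "xs \<in> tuples A s"
    then show "F (G xs) = xs"
      by (intro nth_equalityI) (auto simp: F_def G_def tuples_def)
  qed
  have sums: "(\<Sum>a\<leftarrow>F x. a ^ j) = (\<Sum>i=1..s. x i ^ j)" for x j
  proof -
    have "(\<Sum>a\<leftarrow>F x. a ^ j) = (\<Sum>i<s. x (Suc i) ^ j)"
      by (simp add: F_def comp_def interv_sum_list_conv_sum_set_nat atLeast0LessThan)
    also have "\<dots> = (\<Sum>i=1..s. x i ^ j)"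
      by (rule sum.reindex_bij_witness[of _ "\<lambda>i. i - 1" Suc]) auto
    finally show ?thesis .
  qed
  have same: "list_value (moment_point k) (F x) = list_value (moment_point k) (F y) \<longleftrightarrow>
      (\<forall>j\<in>{1..k}. (\<Sum>i=1..s. x i ^ j) = (\<Sum>i=1..s. y i ^ j))" for x y
    unfolding fun_eq_iff list_value_moment_point sums by meson
  let ?P = "{1..s} \<rightarrow>\<^sub>E A"
  let ?S = "{(x, y). x \<in> ?P \<and> y \<in> ?P \<and> (\<forall>j\<in>{1..k}. (\<Sum>i=1..s. x i ^ j) = (\<Sum>i=1..s. y i ^ j))}"
  let ?T = "{(x, y). x \<in> tuples A s \<and> y \<in> tuples A s \<and> list_value (moment_point k) x = list_value (moment_point k) y}"
  have "?S = {(x, y). x \<in> ?P \<and> y \<in> ?P \<and> list_value (moment_point k) (F x) = list_value (moment_point k) (F y)}"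
    by (simp only: same)
  then have S: "?S = {p \<in> ?P \<times> ?P. map_prod F F p \<in> {(x, y). list_value (moment_point k) x = list_value (moment_point k) y}}"
    by (simp only:) auto
  have T: "?T = {p \<in> tuples A s \<times> tuples A s. p \<in> {(x, y). list_value (moment_point k) x = list_value (moment_point k) y}}"
    by auto
  have "bij_betw (map_prod F F) (?P \<times> ?P) (tuples A s \<times> tuples A s)"
    by (rule bij_betw_map_prod[OF bij bij])
  then have "bij_betw (map_prod F F) ?S ?T"
    unfolding S T by (rule bij_betw_vimage_restrict)
  then show ?thesis unfolding J_def energy_def by (rule bij_betw_same_card)
qed

text \<open>The first coordinate of the moment curve is the identity, so
  \<open>structured_subset\<close> supplies a dense subset of \<open>A\<close> satisfying the growth
  hypothesis of \<open>small_product_set_bound\<close>. The exponent \<open>Q\<close> is chosen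
  before \<open>A\<close> and \<open>K\<close>, hence is uniform in them.\<close>

lemma small_product_set_J_bound:
  fixes t k :: nat
  assumes t: "t \<ge> 1" and k: "k \<ge> 1"
  shows "\<exists>Q. \<forall>(A :: int set) (K :: real). finite A \<and> A \<noteq> {} \<and> K \<ge> 2 \<and>
    real (card A) ^ (2 * t) * real (J t k A) \<le> K * real (J (2 * t) k A) \<and>
    real (card (A * A)) \<le> K * real (card A) \<longrightarrow> real (card A) \<le> K ^ Q"
proof (intro exI allI impI, elim conjE)
  \<comment> \<open>\<open>m\<close> is the order that \<open>small_product_set_bound\<close> asks
    for. The 12 in \<open>R\<close> is 5 + 7: five factors \<open>K\<close> are lost from
    \<open>A\<close> to \<open>B\<close> (four to reach \<open>B'\<close>, one for deleting 0) and
    seven from \<open>B\<close> to \<open>D\<close>.\<close>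
  define m where "m = 6 * t * t"
  define R where "R = 120 * (m + t) + 52 + 2 * t * 12"
  fix A :: "int set" and K :: real
  assume fin: "finite A" and ne: "A \<noteq> {}" and K: "K \<ge> 2"
    and large: "real (card A) ^ (2 * t) * real (J t k A) \<le> K * real (J (2 * t) k A)"
    and small: "real (card (A * A)) \<le> K * real (card A)"
  define \<pi> where "\<pi> = (\<lambda>v :: nat \<Rightarrow> int. v 1)"
  have proj: "\<pi> \<circ> moment_point k = (\<lambda>a. a)" using k by (auto simp: \<pi>_def moment_point_def fun_eq_iff)
  obtain B' where B': "B' \<subseteq> A" "real (card A) \<le> K ^ 4 * real (card B')"
    and growth': "\<And>D m q. D \<subseteq> B' \<Longrightarrow> real (card A) \<le> K ^ q * real (card D) \<Longrightarrow>
      real (card (nsum m B' + uminus ` nsum m B')) \<le> K ^ (120 * (m + t) + 52 + 2 * t * q) * real (card (nsum t D))"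
    using structured_subset[OF fin ne K t, of \<pi> "moment_point k"] large
    unfolding proj J_eq_energy[OF fin] by (auto simp: \<pi>_def)
  have finB': "finite B'" using B' fin finite_subset by blast
  have Kmono: "K ^ i \<le> K ^ j" if "i \<le> j" for i j using that K by (intro power_increasing) auto
  show "real (card A) \<le> K ^ (5 + (7 + 6 * t * R + R))"
  \<comment> \<open>If \<open>B'\<close> has at least two elements, deleting 0 keeps at least half
    of it; otherwise density of \<open>B'\<close> bounds |A| at once.\<close>
  proof (cases "card B' \<le> 1")
    case True
    have "real (card A) \<le> K ^ 4 * 1" using B'(2) True K
      by (meson mult_left_mono of_nat_le_1_iff order_trans zero_le_power linorder_linear not_numeral_le_zero)
    also have "\<dots> \<le> K ^ (5 + (7 + 6 * t * R + R))" using Kmono by simp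
    finally show ?thesis .
  next
    case False
    define B where "B = B' - {0}"
    have finB: "finite B" and BB': "B \<subseteq> B'" and zero: "0 \<notin> B" using finB' by (auto simp: B_def)
    have "card B' \<le> card B + 1" using finB' by (cases "0 \<in> B'") (auto simp: B_def)
    then have half: "real (card B') \<le> 2 * real (card B)" using False by linarith
    have B0: "B \<noteq> {}" using half False by auto
    have "real (card A) \<le> K ^ 4 * (2 * real (card B))"
      using B'(2) half K by (meson mult_left_mono order_trans zero_le_power zero_le_numeral)
    also have "\<dots> \<le> K ^ 4 * (K * real (card B))"
      using K by (intro mult_left_mono mult_right_mono) auto
    also have "\<dots> = K ^ 5 * real (card B)" by (simp add: power_numeral_reduce)
    finally have AB: "real (card A) \<le> K ^ 5 * real (card B)" .
    have "card (B * B) \<le> card (A * A)"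
      using fin BB' B'(1) by (intro card_mono finite_set_times set_times_mono2) auto
    then have "real (card (B * B)) \<le> K * (K ^ 5 * real (card B))"
      using small AB K by (smt (verit) mult_left_mono of_nat_le_iff)
    then have BB: "real (card (B * B)) \<le> K ^ 6 * real (card B)" by (simp add: power_numeral_reduce)
    have growth: "real (card (difference_set (6 * t * t) B)) \<le> K ^ R * real (card (nsum t D))"
      if D: "D \<subseteq> B" "real (card B) \<le> K ^ 7 * real (card D)" for D
    proof -
      have "real (card A) \<le> K ^ 5 * (K ^ 7 * real (card D))"
        using AB D(2) K by (meson mult_left_mono order_trans zero_le_power zero_le_numeral)
      also have "\<dots> = K ^ 12 * real (card D)" by (simp add: mult.assoc[symmetric] flip: power_add)
      finally have "real (card (nsum m B' + uminus ` nsum m B')) \<le> K ^ R * real (card (nsum t D))"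
        unfolding R_def using D BB' by (intro growth') auto
      moreover have "card (difference_set (6 * t * t) B) \<le> card (nsum m B' + uminus ` nsum m B')"
        unfolding difference_set_def m_def using BB' finB'
        by (intro card_mono finite_set_plus set_plus_mono2 image_mono nsum_mono) auto
      ultimately show ?thesis by linarith
    qed
    have "real (card B) \<le> K ^ (7 + 6 * t * R + R)"
      by (rule small_product_set_bound[OF finB B0 zero K t BB growth])
    then have "K ^ 5 * real (card B) \<le> K ^ 5 * K ^ (7 + 6 * t * R + R)"
      using K by (intro mult_left_mono) auto
    then show ?thesis using AB by (simp only: power_add[symmetric])
  qed
qed

text \<open>A number above the infimum exceeds some admissible exponent, whose bound is weakened to
  \<Lambda> + \<epsilon> using |A| \<ge> 1.\<close>

lemma eventually_J_le:
  fixes \<Lambda> \<epsilon> :: real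
  assumes "ereal \<Lambda> = Lambda_inf" "\<epsilon> > 0" and "s \<ge> 1" "k \<ge> 1" "real s \<ge> real k * (real k + 1) / 2"
  shows "\<exists>N. \<forall>A :: int set. finite A \<and> A \<noteq> {} \<and> card A \<ge> N \<longrightarrow>
    real (J s k A) \<le> real (card A) powr (2 * real s - real k * (real k + 1) / 2 + \<Lambda> + \<epsilon>)"
proof -
  have "Lambda_inf < ereal (\<Lambda> + \<epsilon>)" using assms by (simp flip: assms(1))
  then obtain l where l: "l \<in> admissible_exponents" "l < \<Lambda> + \<epsilon>"
    unfolding Lambda_inf_def by (auto simp: Inf_less_iff)
  then obtain N where N: "\<And>A :: int set. finite A \<and> A \<noteq> {} \<and> card A \<ge> N \<Longrightarrow>
      real (J s k A) \<le> real (card A) powr (2 * real s - real k * (real k + 1) / 2) * real (card A) powr l"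
    using assms unfolding admissible_exponents_def by blast
  have "real (J s k A) \<le> real (card A) powr (2 * real s - real k * (real k + 1) / 2 + \<Lambda> + \<epsilon>)"
    if A: "finite A" "A \<noteq> {}" "card A \<ge> N" for A :: "int set"
  proof -
    have "card A > 0" using A by (simp add: card_gt_0_iff)
    then have "1 \<le> real (card A)" by simp
    have "real (J s k A) \<le> real (card A) powr (2 * real s - real k * (real k + 1) / 2 + l)"
      using N A by (simp add: powr_add)
    also have "\<dots> \<le> real (card A) powr (2 * real s - real k * (real k + 1) / 2 + \<Lambda> + \<epsilon>)"
      using l \<open>1 \<le> real (card A)\<close> by (intro powr_mono) auto
    finally show ?thesis .
  qed
  then show ?thesis by blast
qed

theorem theorem6p3:
  fixes k :: nat and \<Lambda> :: real
  assumes "k \<ge> 1" and "ereal \<Lambda> = Lambda_inf"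
  shows "\<exists>\<delta>::real. \<delta> > 0 \<and>
    (\<forall>s::nat. s \<ge> k * (k + 1) \<longrightarrow>
      (\<exists>\<epsilon>\<^sub>0::real. \<epsilon>\<^sub>0 > 0 \<and>
        (\<forall>\<epsilon>::real. 0 < \<epsilon> \<and> \<epsilon> \<le> \<epsilon>\<^sub>0 \<longrightarrow>
          (\<exists>N::nat. \<forall>(A :: int set) (\<alpha>::real).
            finite A \<and> A \<noteq> {} \<and> card A \<ge> N \<and> 0 < \<alpha> \<and> \<alpha> \<le> 1 \<and>
            ln (inverse \<alpha>) \<le> \<epsilon> * (real k * (real k + 1) - 2 * \<Lambda>) / 43200 * ln (real (card A)) \<and>
            real (J s k A) = \<alpha> * real (card A) powr (2 * real s - real k * (real k + 1) / 2 + \<Lambda>) \<longrightarrow>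
            real (card (A * A)) > real (card A) powr (1 + \<delta>)))))"
proof -
  \<comment> \<open>This is the critical number of variables, the least one for which admissible
    exponents bound \<open>J\<close>. The division is exact because k (k + 1) is even.\<close>
  define t where "t = k * (k + 1) div 2"
  have t2: "2 * t = k * (k + 1)" by (simp add: t_def)
  have rt: "real t = real k * (real k + 1) / 2"
    using arg_cong[OF t2, of real] by (simp add: algebra_simps)
  have t: "t \<ge> 1" using t2 assms(1) by (cases t) auto
  obtain Q where Q: "\<And>(A :: int set) K. finite A \<Longrightarrow> A \<noteq> {} \<Longrightarrow> K \<ge> 2 \<Longrightarrow>
      real (card A) ^ (2 * t) * real (J t k A) \<le> K * real (J (2 * t) k A) \<Longrightarrow>
      real (card (A * A)) \<le> K * real (card A) \<Longrightarrow> real (card A) \<le> K ^ Q"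
    using small_product_set_J_bound[OF t assms(1)] by blast
  \<comment> \<open>With K = n^\<delta> this choice makes K^Q smaller than n, contradicting the
    bound from \<open>Q\<close>. It is fixed before \<open>s\<close>, \<open>\<epsilon>\<close> and
    \<open>A\<close>.\<close>
  define \<delta> where "\<delta> = 1 / (real Q + 1)"
  have \<delta>: "\<delta> > 0" "\<delta> * real Q < 1" by (simp_all add: \<delta>_def)
  define c where "c = real k * (real k + 1) - 2 * \<Lambda>"
  \<comment> \<open>As 21600 is half of 43200, every
    \<open>\<epsilon> \<le> \<epsilon>\<^sub>0\<close> satisfies \<epsilon> c / 43200 \<le> \<delta>
    / 2; adding 1 to |c| keeps the denominator positive.\<close>
  define \<epsilon>\<^sub>0 where "\<epsilon>\<^sub>0 = 21600 * \<delta> / (\<bar>c\<bar> + 1)"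
  have "\<epsilon>\<^sub>0 > 0" using \<delta> by (simp add: \<epsilon>\<^sub>0_def)
  obtain N1 where N1: "\<And>A :: int set. finite A \<Longrightarrow> A \<noteq> {} \<Longrightarrow> card A \<ge> N1 \<Longrightarrow>
      real (J t k A) \<le> real (card A) powr (2 * real t - real k * (real k + 1) / 2 + \<Lambda> + \<delta> / 2)"
    using eventually_J_le[OF assms(2), of "\<delta> / 2" t k] \<delta> t assms(1) rt by auto
  \<comment> \<open>The power of 2 guarantees n^\<delta> \<ge> 2, as \<open>K \<ge> 2\<close>
    demands.\<close>
  define N where "N = max N1 (2 ^ (Q + 1))"
  have "real (card (A * A)) > real (card A) powr (1 + \<delta>)"
    if s: "s \<ge> k * (k + 1)" and \<epsilon>: "0 < \<epsilon>" "\<epsilon> \<le> \<epsilon>\<^sub>0"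
      and A: "finite A" "A \<noteq> {}" "card A \<ge> N" and \<alpha>: "0 < \<alpha>"
      and ln\<alpha>: "ln (inverse \<alpha>) \<le> \<epsilon> * (real k * (real k + 1) - 2 * \<Lambda>) / 43200 * ln (real (card A))"
      and J: "real (J s k A) = \<alpha> * real (card A) powr (2 * real s - real k * (real k + 1) / 2 + \<Lambda>)"
    for s \<epsilon> \<alpha> and A :: "int set"
  proof (rule ccontr)
    assume "\<not> ?thesis"
    then have small: "real (card (A * A)) \<le> real (card A) powr (1 + \<delta>)" by simp
    define n where "n = real (card A)"
    define K where "K = n powr \<delta>"
    have "2 ^ (Q + 1) \<le> card A" using A(3) by (simp add: N_def)
    then have nQ: "2 ^ (Q + 1) \<le> n" unfolding n_def by (metis of_nat_le_iff of_nat_numeral of_nat_power)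
    moreover have "(2::real) \<le> 2 ^ (Q + 1)" by simp
    ultimately have n2: "2 \<le> n" by linarith
    have "2 = (2::real) powr (real (Q + 1) * \<delta>)" by (simp add: \<delta>_def add.commute)
    also have "\<dots> = (2 powr real (Q + 1)) powr \<delta>" by (simp only: powr_powr)
    also have "\<dots> = (2 ^ (Q + 1)) powr \<delta>" by (subst powr_realpow) simp_all
    also have "\<dots> \<le> K" unfolding K_def using nQ \<delta> by (intro powr_mono2) auto
    finally have K2: "K \<ge> 2" .
    have "\<epsilon> * c \<le> \<epsilon> * \<bar>c\<bar>" using \<epsilon> by (intro mult_left_mono) auto
    also have "\<dots> \<le> \<epsilon>\<^sub>0 * \<bar>c\<bar>" using \<epsilon> by (intro mult_right_mono) auto
    also have "\<dots> \<le> \<epsilon>\<^sub>0 * (\<bar>c\<bar> + 1)" using \<open>\<epsilon>\<^sub>0 > 0\<close> by simp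
    also have "\<dots> = 21600 * \<delta>" by (simp add: \<epsilon>\<^sub>0_def)
    finally have "\<epsilon> * c / 43200 \<le> \<delta> / 2" by simp
    then have "\<epsilon> * c / 43200 * ln n \<le> \<delta> / 2 * ln n" using n2 by (intro mult_right_mono) auto
    moreover have "ln (inverse \<alpha>) \<le> \<epsilon> * c / 43200 * ln n" using ln\<alpha> unfolding c_def n_def .
    ultimately have "- ln \<alpha> \<le> \<delta> / 2 * ln n" unfolding ln_inverse by linarith
    then have "exp (- (\<delta> / 2 * ln n)) \<le> exp (ln \<alpha>)" by simp
    then have \<alpha>_ge: "n powr (- (\<delta> / 2)) \<le> \<alpha>" using n2 \<alpha> by (simp add: powr_def)
    \<comment> \<open>The r pairs of variables beyond 2 t are removed at a cost of n^2 each.\<close>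
    obtain r where r: "s = r + 2 * t" using s t2 by (metis le_Suc_ex add.commute)
    have "J s k A \<le> card A ^ (2 * r) * J (2 * t) k A"
      unfolding J_eq_energy[OF A(1)] r by (rule energy_add[OF A(1)])
    then have "real (J s k A) \<le> real (card A ^ (2 * r) * J (2 * t) k A)" using of_nat_le_iff by blast
    then have Js: "real (J s k A) \<le> n powr (2 * real r) * real (J (2 * t) k A)"
      using n2 by (simp add: n_def powr_realpow[symmetric])
    have "n powr (2 * real r) * (n powr (4 * real t) * n powr (\<Lambda> - real t + - (\<delta> / 2)))
        = n powr (- (\<delta> / 2)) * n powr (2 * real s - real k * (real k + 1) / 2 + \<Lambda>)"
      unfolding rt[symmetric] r by (simp add: algebra_simps flip: powr_add)
    also have "\<dots> \<le> real (J s k A)" unfolding J n_def[symmetric] using \<alpha>_ge by (intro mult_right_mono) auto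
    also note Js
    finally have "n powr (4 * real t) * n powr (\<Lambda> - real t + - (\<delta> / 2)) \<le> real (J (2 * t) k A)"
      by (rule mult_left_le_imp_le) (use n2 in simp)
    \<comment> \<open>The factor n^(\<delta> / 2) lost through \<alpha> and the factor n^(\<delta> /
      2) lost in approximating the infimum multiply to exactly \<open>K\<close>.\<close>
    then have "n powr \<delta> * (n powr (4 * real t) * n powr (\<Lambda> - real t + - (\<delta> / 2))) \<le> K * real (J (2 * t) k A)"
      unfolding K_def by (intro mult_left_mono) auto
    moreover have "real (J t k A) \<le> n powr (2 * real t - real k * (real k + 1) / 2 + \<Lambda> + \<delta> / 2)"
      using N1 A by (simp add: N_def n_def)
    then have "n powr (2 * real t) * real (J t k A) \<le> n powr (2 * real t) * n powr (2 * real t - real t + \<Lambda> + \<delta> / 2)"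
      unfolding rt[symmetric] by (intro mult_left_mono) auto
    moreover have "n powr (2 * real t) * n powr (2 * real t - real t + \<Lambda> + \<delta> / 2)
        = n powr \<delta> * (n powr (4 * real t) * n powr (\<Lambda> - real t + - (\<delta> / 2)))"
      by (simp add: algebra_simps flip: powr_add)
    ultimately have "n powr (2 * real t) * real (J t k A) \<le> K * real (J (2 * t) k A)" by linarith
    then have large: "real (card A) ^ (2 * t) * real (J t k A) \<le> K * real (J (2 * t) k A)"
      using n2 by (simp add: n_def powr_realpow[symmetric])
    have "real (card (A * A)) \<le> K * real (card A)"
      using small n2 by (simp add: K_def n_def powr_add mult.commute)
    then have "n \<le> K ^ Q" unfolding n_def by (intro Q A K2 large)
    also have "K ^ Q = n powr (\<delta> * real Q)" using n2 by (simp add: K_def powr_powr flip: powr_realpow)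
    also have "\<dots> < n powr 1" using \<delta> n2 by (intro powr_less_mono) auto
    finally show False using n2 by simp
  qed
  then show ?thesis using \<delta>(1) \<open>\<epsilon>\<^sub>0 > 0\<close> by blast
qed

end
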